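(* Let $n\ge2$, let $Q$ be an $n$-pre-admissible quiver, $\mathbf{k}$ a field and $\Lambda=\mathbf{k}Q/\mathcal{J}^2$ ($\mathcal{J}$ the arrow ideal). Then: (a) $\Lambda$ is a string algebra. (b) If $\ell_k\cdots\ell_1$ is a string in $\Lambda$, then $k\le2$; in particular there are no bands in $\Lambda$. (c) $\Lambda$ is representation-finite. (d) If $M$ is an indecomposable $\Lambda$-module which is not simple, then $M$ is projective or injective.
   Context: Quivers are finite and connected; modules are finite-dimensional right modules. $\delta(v)=(\delta^-(v),\delta^+(v))$ counts arrows ending and starting at $v$. $Q$ is $n$-pre-admissible if: (i) every $\delta(v)\in\{(0,0),(0,1),(1,0),(1,1),(1,2),(2,1)\}$, with $(2,2)$ also allowed when $n=2$; (ii) at most one arrow from any vertex to any vertex; (iii) $\delta^+(v)+\delta^-(u)\le 3$ for every arrow $v\to u$. A bound quiver algebra $\mathbf{k}Q/\mathcal{I}$ is a string algebra if: each vertex has at most two incoming and at most two outgoing arrows; for every arrow $\alpha$ there is at most one arrow $\beta$ with $\beta\alpha\notin\mathcal{I}$ and at most one arrow $\gamma$ with $\alpha\gamma\notin\mathcal{I}$; and $\mathcal{I}$ is generated by paths. For each arrow $\alpha$ introduce a formal inverse $\alpha^-$ with $s(\alpha^-)=t(\alpha)$, $t(\alpha^-)=s(\alpha)$. A string of length $k\ge1$ is a sequence $\ell_k\cdots\ell_1$ of arrows and inverse arrows with $t(\ell_i)=s(\ell_{i+1})$, $\ell_i\ne\ell_{i+1}^-$, such that no subword $\ell_{i+r}\cdots\ell_i$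 consisting of direct arrows, nor the inverse $\ell_i^-\cdots\ell_{i+r}^-$ of a subword consisting of inverse arrows, lies in $\mathcal{I}$; there are also trivial strings of length $0$ at each vertex. A band is a string $\bm\ell$ with $s(\ell_1)=t(\ell_k)$ such that every power $\bm\ell^q$ is a string and $\bm\ell$ is not a proper power of another string. *)

theory Defs
  imports Main "Jordan_Normal_Form.Matrix"
begin

section \<open>Quivers\<close>

record ('v, 'a) quiver =
  verts :: "'v set"
  arrs  :: "'a set"
  src   :: "'a \<Rightarrow> 'v"
  tgt   :: "'a \<Rightarrow> 'v"

definition wf_quiver :: "('v, 'a) quiver \<Rightarrow> bool" where
  "wf_quiver Q \<longleftrightarrow> (\<forall>a\<in>arrs Q. src Q a \<in> verts Q \<and> tgt Q a \<in> verts Q)"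

text \<open>finite and connected (underlying undirected graph connected, nonempty)\<close>
definition finite_connected_quiver :: "('v, 'a) quiver \<Rightarrow> bool" where
  "finite_connected_quiver Q \<longleftrightarrow> wf_quiver Q \<and> finite (verts Q) \<and> finite (arrs Q)
     \<and> verts Q \<noteq> {}
     \<and> (\<forall>u\<in>verts Q. \<forall>v\<in>verts Q.
          (u, v) \<in> ({(src Q a, tgt Q a) | a. a \<in> arrs Q}
                     \<union> {(tgt Q a, src Q a) | a. a \<in> arrs Q})\<^sup>*)"

definition indeg :: "('v, 'a) quiver \<Rightarrow> 'v \<Rightarrow> nat" where
  "indeg Q v = card {a \<in> arrs Q. tgt Q a = v}"

definition outdeg :: "('v, 'a) quiver \<Rightarrow> 'v \<Rightarrow> nat" where
  "outdeg Q v = card {a \<in> arrs Q. src Q a = v}"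

definition pre_admissible :: "nat \<Rightarrow> ('v, 'a) quiver \<Rightarrow> bool" where
  "pre_admissible n Q \<longleftrightarrow>
     (\<forall>v\<in>verts Q. (indeg Q v, outdeg Q v) \<in> {(0,0),(0,1),(1,0),(1,1),(1,2),(2,1)}
                   \<or> (n = 2 \<and> (indeg Q v, outdeg Q v) = (2,2)))
   \<and> (\<forall>a\<in>arrs Q. \<forall>b\<in>arrs Q. src Q a = src Q b \<and> tgt Q a = tgt Q b \<longrightarrow> a = b)
   \<and> (\<forall>a\<in>arrs Q. outdeg Q (src Q a) + indeg Q (tgt Q a) \<le> 3)"

section \<open>Monomial bound quiver algebras, strings and bands\<close>

text \<open>A path is a list of arrows [a1,...,am], a1 applied first (i.e. the path am...a1).
  An ideal generated by paths is encoded by the predicate telling which paths lie in it.\<close>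

definition J2_path :: "'a list \<Rightarrow> bool" where
  "J2_path p \<longleftrightarrow> 2 \<le> length p"

definition string_algebra :: "('v, 'a) quiver \<Rightarrow> ('a list \<Rightarrow> bool) \<Rightarrow> bool" where
  "string_algebra Q inI \<longleftrightarrow>
     (\<forall>v\<in>verts Q. indeg Q v \<le> 2 \<and> outdeg Q v \<le> 2)
   \<and> (\<forall>\<alpha>\<in>arrs Q.
        card {\<beta>\<in>arrs Q. src Q \<beta> = tgt Q \<alpha> \<and> \<not> inI [\<alpha>, \<beta>]} \<le> 1
      \<and> card {\<gamma>\<in>arrs Q. tgt Q \<gamma> = src Q \<alpha> \<and> \<not> inI [\<gamma>, \<alpha>]} \<le> 1)"

text \<open>Letters: (a, True) is the arrow a, (a, False) its formal inverse.\<close>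
definition sL :: "('v, 'a) quiver \<Rightarrow> 'a \<times> bool \<Rightarrow> 'v" where
  "sL Q l = (if snd l then src Q (fst l) else tgt Q (fst l))"
definition tL :: "('v, 'a) quiver \<Rightarrow> 'a \<times> bool \<Rightarrow> 'v" where
  "tL Q l = (if snd l then tgt Q (fst l) else src Q (fst l))"
definition invL :: "'a \<times> bool \<Rightarrow> 'a \<times> bool" where
  "invL l = (fst l, \<not> snd l)"

text \<open>A string of length k \<ge> 1, written l_k ... l_1, is the list [l_1, ..., l_k].\<close>
definition is_string :: "('v, 'a) quiver \<Rightarrow> ('a list \<Rightarrow> bool) \<Rightarrow> ('a \<times> bool) list \<Rightarrow> bool" where
  "is_string Q inI w \<longleftrightarrow> w \<noteq> [] \<and> fst ` set w \<subseteq> arrs Q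
   \<and> (\<forall>i. Suc i < length w \<longrightarrow> tL Q (w ! i) = sL Q (w ! Suc i) \<and> w ! Suc i \<noteq> invL (w ! i))
   \<and> (\<forall>i r. i + r < length w \<and> (\<forall>j\<in>{i..i+r}. snd (w ! j))
        \<longrightarrow> \<not> inI (map fst (take (Suc r) (drop i w))))
   \<and> (\<forall>i r. i + r < length w \<and> (\<forall>j\<in>{i..i+r}. \<not> snd (w ! j))
        \<longrightarrow> \<not> inI (rev (map fst (take (Suc r) (drop i w)))))"

definition is_band :: "('v, 'a) quiver \<Rightarrow> ('a list \<Rightarrow> bool) \<Rightarrow> ('a \<times> bool) list \<Rightarrow> bool" where
  "is_band Q inI w \<longleftrightarrow> is_string Q inI w \<and> sL Q (hd w) = tL Q (last w)
   \<and> (\<forall>q\<ge>1. is_string Q inI (concat (replicate q w)))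
   \<and> \<not> (\<exists>u q. q \<ge> 2 \<and> is_string Q inI u \<and> w = concat (replicate q u))"

section \<open>Finite-dimensional modules over kQ/J^2, as bound quiver representations\<close>

record ('v, 'a, 'k) rep =
  rdim :: "'v \<Rightarrow> nat"
  rmap :: "'a \<Rightarrow> 'k mat"

definition is_rep_J2 :: "('v, 'a) quiver \<Rightarrow> ('v, 'a, 'k::field) rep \<Rightarrow> bool" where
  "is_rep_J2 Q M \<longleftrightarrow>
     (\<forall>a\<in>arrs Q. rmap M a \<in> carrier_mat (rdim M (tgt Q a)) (rdim M (src Q a)))
   \<and> (\<forall>a\<in>arrs Q. \<forall>b\<in>arrs Q. src Q b = tgt Q a \<longrightarrow>
        rmap M b * rmap M a = 0\<^sub>m (rdim M (tgt Q b)) (rdim M (src Q a)))"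

definition rep_nonzero :: "('v, 'a) quiver \<Rightarrow> ('v, 'a, 'k) rep \<Rightarrow> bool" where
  "rep_nonzero Q M \<longleftrightarrow> (\<exists>v\<in>verts Q. rdim M v > 0)"

definition is_hom :: "('v, 'a) quiver \<Rightarrow> ('v, 'a, 'k::field) rep \<Rightarrow> ('v, 'a, 'k) rep
    \<Rightarrow> ('v \<Rightarrow> 'k mat) \<Rightarrow> bool" where
  "is_hom Q M N f \<longleftrightarrow>
     (\<forall>v\<in>verts Q. f v \<in> carrier_mat (rdim N v) (rdim M v))
   \<and> (\<forall>a\<in>arrs Q. f (tgt Q a) * rmap M a = rmap N a * f (src Q a))"

definition rep_iso :: "('v, 'a) quiver \<Rightarrow> ('v, 'a, 'k::field) rep \<Rightarrow> ('v, 'a, 'k) rep \<Rightarrow> bool" where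
  "rep_iso Q M N \<longleftrightarrow> (\<exists>f g. is_hom Q M N f \<and> is_hom Q N M g
     \<and> (\<forall>v\<in>verts Q. g v * f v = 1\<^sub>m (rdim M v) \<and> f v * g v = 1\<^sub>m (rdim N v)))"

definition rep_dsum :: "('v, 'a) quiver \<Rightarrow> ('v, 'a, 'k::field) rep \<Rightarrow> ('v, 'a, 'k) rep
    \<Rightarrow> ('v, 'a, 'k) rep" where
  "rep_dsum Q M N = \<lparr> rdim = (\<lambda>v. rdim M v + rdim N v),
     rmap = (\<lambda>a. four_block_mat (rmap M a) (0\<^sub>m (rdim M (tgt Q a)) (rdim N (src Q a)))
                                (0\<^sub>m (rdim N (tgt Q a)) (rdim M (src Q a))) (rmap N a)) \<rparr>"

definition indecomposable :: "('v, 'a) quiver \<Rightarrow> ('v, 'a, 'k::field) rep \<Rightarrow> bool" where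
  "indecomposable Q M \<longleftrightarrow> rep_nonzero Q M \<and>
     \<not> (\<exists>N1 N2. is_rep_J2 Q N1 \<and> is_rep_J2 Q N2 \<and> rep_nonzero Q N1 \<and> rep_nonzero Q N2
               \<and> rep_iso Q M (rep_dsum Q N1 N2))"

definition is_subspace :: "nat \<Rightarrow> 'k::field vec set \<Rightarrow> bool" where
  "is_subspace n U \<longleftrightarrow> U \<subseteq> carrier_vec n \<and> 0\<^sub>v n \<in> U
     \<and> (\<forall>x\<in>U. \<forall>y\<in>U. x + y \<in> U) \<and> (\<forall>c. \<forall>x\<in>U. c \<cdot>\<^sub>v x \<in> U)"

definition is_subrep :: "('v, 'a) quiver \<Rightarrow> ('v, 'a, 'k::field) rep \<Rightarrow> ('v \<Rightarrow> 'k vec set) \<Rightarrow> bool" where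
  "is_subrep Q M U \<longleftrightarrow> (\<forall>v\<in>verts Q. is_subspace (rdim M v) (U v))
     \<and> (\<forall>a\<in>arrs Q. \<forall>x\<in>U (src Q a). rmap M a *\<^sub>v x \<in> U (tgt Q a))"

definition simple_rep :: "('v, 'a) quiver \<Rightarrow> ('v, 'a, 'k::field) rep \<Rightarrow> bool" where
  "simple_rep Q M \<longleftrightarrow> rep_nonzero Q M \<and>
     (\<forall>U. is_subrep Q M U \<longrightarrow> (\<forall>v\<in>verts Q. U v = {0\<^sub>v (rdim M v)})
                             \<or> (\<forall>v\<in>verts Q. U v = carrier_vec (rdim M v)))"

definition is_epi :: "('v, 'a) quiver \<Rightarrow> ('v, 'a, 'k::field) rep \<Rightarrow> ('v, 'a, 'k) rep
    \<Rightarrow> ('v \<Rightarrow> 'k mat) \<Rightarrow> bool" where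
  "is_epi Q M N f \<longleftrightarrow> is_hom Q M N f \<and>
     (\<forall>v\<in>verts Q. \<forall>y\<in>carrier_vec (rdim N v). \<exists>x\<in>carrier_vec (rdim M v). f v *\<^sub>v x = y)"

definition is_mono :: "('v, 'a) quiver \<Rightarrow> ('v, 'a, 'k::field) rep \<Rightarrow> ('v, 'a, 'k) rep
    \<Rightarrow> ('v \<Rightarrow> 'k mat) \<Rightarrow> bool" where
  "is_mono Q M N f \<longleftrightarrow> is_hom Q M N f \<and>
     (\<forall>v\<in>verts Q. \<forall>x\<in>carrier_vec (rdim M v). \<forall>y\<in>carrier_vec (rdim M v).
        f v *\<^sub>v x = f v *\<^sub>v y \<longrightarrow> x = y)"

text \<open>Projective / injective in the category of finite-dimensional modules.\<close>
definition projective_rep :: "('v, 'a) quiver \<Rightarrow> ('v, 'a, 'k::field) rep \<Rightarrow> bool" where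
  "projective_rep Q P \<longleftrightarrow> (\<forall>M N g f. is_rep_J2 Q M \<and> is_rep_J2 Q N \<and> is_epi Q M N g
       \<and> is_hom Q P N f \<longrightarrow> (\<exists>h. is_hom Q P M h \<and> (\<forall>v\<in>verts Q. g v * h v = f v)))"

definition injective_rep :: "('v, 'a) quiver \<Rightarrow> ('v, 'a, 'k::field) rep \<Rightarrow> bool" where
  "injective_rep Q I \<longleftrightarrow> (\<forall>M N g f. is_rep_J2 Q M \<and> is_rep_J2 Q N \<and> is_mono Q M N g
       \<and> is_hom Q M I f \<longrightarrow> (\<exists>h. is_hom Q N I h \<and> (\<forall>v\<in>verts Q. h v * g v = f v)))"

text \<open>Representation-finite: finitely many isoclasses of indecomposable modules.
  The field is the type parameter 'k.\<close>
definition rep_finite_J2 :: "('v, 'a) quiver \<Rightarrow> 'k::field itself \<Rightarrow> bool" where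
  "rep_finite_J2 Q (_ :: 'k itself) \<longleftrightarrow> (\<exists>S :: ('v, 'a, 'k) rep set. finite S \<and>
     (\<forall>M. is_rep_J2 Q M \<and> indecomposable Q M \<longrightarrow> (\<exists>N\<in>S. rep_iso Q M N)))"

end

theory Submission
  imports Defs
begin

text \<open>
  Let \<open>M\<close> be indecomposable. If no arrow acts on \<open>M\<close>, then \<open>M\<close> is simple. Otherwise let the arrow
  \<open>a : v \<rightarrow> u\<close> act nontrivially. Since \<open>\<delta>\<^sup>+(v) + \<delta>\<^sup>-(u) \<le> 3\<close>, up to duality \<open>a\<close> is the only arrow
  leaving \<open>v\<close>. If some \<open>a x\<close> is not in the image of the other arrow into \<open>u\<close>, a functional separating
  them yields an idempotent endomorphism of \<open>M\<close> with image the submodule generated by \<open>x\<close>, which is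
  then \<open>M\<close>, the projective at \<open>v\<close>. Otherwise a common nonzero vector \<open>a x = b z\<close> of the two images
  yields dually an idempotent with image the injective at \<open>u\<close>. So \<open>M\<close> is determined up to
  isomorphism by its type (simple, projective, injective) and a vertex.
\<close>

section \<open>Linear algebra\<close>

text \<open>The idempotent is a composite M -> P(v) -> M. As J^2 = 0, the projective P(v) has a
  basis consisting of one generator and the arrows leaving v, so a map into it is a small family of
  functionals on M (\<open>gen_data\<close>), while a map out of it is the choice of a vector. One
  matrix formula, \<open>gen_hom\<close>, writes down the composite with an arbitrary target N in
  place of the second M. Once the idempotent is the identity, this formula gives M the universal
  property of P(v); projectivity and uniqueness up to isomorphism follow without a model of P(v).

  The injective case is the same argument for the transposed representation over the opposite
  quiver. There vectors of M act as functionals, so a common vector of two images is the dual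
  counterpart of a functional. The degree bound enters at both arrows into u: applied to the second
  arrow b, it makes b the only arrow leaving its source.

  Loops are not excluded. The functional attached to a loop lives on the same space as the one
  attached to the generator, and it must be corrected before the idempotent fixes x.\<close>

lemma eq_mat_if_eq_on_vec:
  fixes A B :: "'k::field mat"
  assumes A: "A \<in> carrier_mat m n" and B: "B \<in> carrier_mat m n"
    and eq: "\<And>x. x \<in> carrier_vec n \<Longrightarrow> A *\<^sub>v x = B *\<^sub>v x"
  shows "A = B"
proof (rule eq_matI)
  fix i j assume ij: "i < dim_row B" "j < dim_col B"
  have "col A j = A *\<^sub>v unit_vec n j" "col B j = B *\<^sub>v unit_vec n j"
    using A B ij by (auto intro!: eq_vecI)
  then have "col A j = col B j" using eq[of "unit_vec n j"] by simp
  then have "col A j $ i = col B j $ i" by simp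
  then show "A $$ (i, j) = B $$ (i, j)" using A B ij by simp
qed (use A B in auto)

lemma minus_zero_mat [simp]:
  "A \<in> carrier_mat m n \<Longrightarrow> A - 0\<^sub>m m n = (A :: 'k::field mat)"
  by (intro eq_matI) auto

lemma zero_mat_mult_vec [simp]:
  "x \<in> carrier_vec n \<Longrightarrow> 0\<^sub>m m n *\<^sub>v x = (0\<^sub>v m :: 'k::field vec)"
  by (intro eq_vecI) auto

lemma mat_assoc:
  fixes A B C :: "'k::field mat"
  assumes "dim_col A = dim_row B" "dim_col B = dim_row C"
  shows "A * B * C = A * (B * C)"
  using assms by (intro assoc_mult_mat[of _ "dim_row A" "dim_row B" _ "dim_row C" _ "dim_col C"]) auto

text \<open>Induction on \<open>m\<close>. If the last functional vanishes on the common kernel of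
  the others, it gets coefficient 0. Otherwise a vector \<open>z\<close> of that kernel is not
  killed by \<open>b m\<close>, and subtracting a suitable multiple of \<open>b m\<close> from
  \<open>\<psi>\<close> leaves a functional that vanishes on the common kernel of the
  others.\<close>

lemma functional_in_span:
  fixes b :: "nat \<Rightarrow> 'k::field vec"
  assumes b: "\<And>i. i < m \<Longrightarrow> b i \<in> carrier_vec n" and \<psi>: "\<psi> \<in> carrier_vec n"
    and "\<And>x. x \<in> carrier_vec n \<Longrightarrow> (\<And>i. i < m \<Longrightarrow> b i \<bullet> x = 0) \<Longrightarrow> \<psi> \<bullet> x = 0"
  shows "\<exists>c. \<forall>x\<in>carrier_vec n. \<psi> \<bullet> x = (\<Sum>i<m. c i * (b i \<bullet> x))"
  using assms
proof (induction m arbitrary: \<psi>)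
  case 0
  then show ?case by auto
next
  case (Suc m)
  show ?case
  proof (cases "\<forall>x\<in>carrier_vec n. (\<forall>i<m. b i \<bullet> x = 0) \<longrightarrow> b m \<bullet> x = 0")
    case True
    have "\<exists>c. \<forall>x\<in>carrier_vec n. \<psi> \<bullet> x = (\<Sum>i<m. c i * (b i \<bullet> x))"
    proof (rule Suc.IH)
      fix x :: "'k vec" assume x: "x \<in> carrier_vec n" "\<And>i. i < m \<Longrightarrow> b i \<bullet> x = 0"
      then have "b m \<bullet> x = 0" using True by blast
      then show "\<psi> \<bullet> x = 0" using Suc.prems(3)[OF x(1)] x(2) less_Suc_eq by metis
    qed (use Suc.prems in auto)
    then obtain c where c: "\<forall>x\<in>carrier_vec n. \<psi> \<bullet> x = (\<Sum>i<m. c i * (b i \<bullet> x))" by blast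
    show ?thesis
    proof (intro exI[of _ "c(m := 0)"] ballI)
      fix x :: "'k vec" assume "x \<in> carrier_vec n"
      then show "\<psi> \<bullet> x = (\<Sum>i<Suc m. (c(m := 0)) i * (b i \<bullet> x))"
        using c by simp
    qed
  next
    case False
    then obtain z where z: "z \<in> carrier_vec n" "\<And>i. i < m \<Longrightarrow> b i \<bullet> z = 0" "b m \<bullet> z \<noteq> 0" by blast
    \<comment> \<open>The multiple of \<open>b m\<close> for which \<open>\<psi>'\<close> below
      vanishes at \<open>z\<close>.\<close>
    define t where "t = (\<psi> \<bullet> z) / (b m \<bullet> z)"
    have bm: "b m \<in> carrier_vec n" using Suc.prems(1) by simp
    have \<psi>: "\<psi> \<in> carrier_vec n" by (rule Suc.prems(2))
    define \<psi>' where "\<psi>' = \<psi> - t \<cdot>\<^sub>v b m"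
    have \<psi>': "\<psi>' \<in> carrier_vec n" using \<psi> bm by (simp add: \<psi>'_def)
    have ev: "\<psi>' \<bullet> x = \<psi> \<bullet> x - t * (b m \<bullet> x)" if "x \<in> carrier_vec n" for x
      unfolding \<psi>'_def using \<psi> bm that by (simp add: minus_scalar_prod_distrib[of _ n])
    have "\<exists>c. \<forall>x\<in>carrier_vec n. \<psi>' \<bullet> x = (\<Sum>i<m. c i * (b i \<bullet> x))"
    proof (rule Suc.IH)
      show "\<psi>' \<in> carrier_vec n" by (rule \<psi>')
      show "b i \<in> carrier_vec n" if "i < m" for i using Suc.prems(1) that by simp
      fix x :: "'k vec" assume x: "x \<in> carrier_vec n" "\<And>i. i < m \<Longrightarrow> b i \<bullet> x = 0"
      \<comment> \<open>Correcting \<open>x\<close> by a multiple of \<open>z\<close> moves it into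
        the kernel of \<open>b m\<close> too, and \<open>\<psi>'\<close> does not see the
        correction.\<close>
      define s where "s = (b m \<bullet> x) / (b m \<bullet> z)"
      define y where "y = x - s \<cdot>\<^sub>v z"
      have y: "y \<in> carrier_vec n" using x z by (simp add: y_def)
      have evy: "f \<bullet> y = f \<bullet> x - s * (f \<bullet> z)" if "f \<in> carrier_vec n" for f
        unfolding y_def using that x z by (simp add: scalar_prod_minus_distrib[of _ n])
      have "b i \<bullet> y = 0" if "i < Suc m" for i
      proof (cases "i = m")
        case True
        then show ?thesis using evy[OF bm] z(3) by (simp add: s_def)
      next
        case False
        then show ?thesis using that evy Suc.prems(1) x z(2) by (simp add: less_Suc_eq)
      qed
      then have "\<psi> \<bullet> y = 0" using Suc.prems(3)[OF y] by blast
      then show "\<psi>' \<bullet> x = 0"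
        using ev[OF x(1)] evy[OF \<psi>] by (simp add: s_def t_def)
    qed
    then obtain c where c: "\<forall>x\<in>carrier_vec n. \<psi>' \<bullet> x = (\<Sum>i<m. c i * (b i \<bullet> x))" by blast
    show ?thesis
    proof (intro exI[of _ "c(m := t)"] ballI)
      fix x :: "'k vec" assume x: "x \<in> carrier_vec n"
      show "\<psi> \<bullet> x = (\<Sum>i<Suc m. (c(m := t)) i * (b i \<bullet> x))"
        using c ev[OF x] x by (simp add: algebra_simps)
    qed
  qed
qed

text \<open>The annihilator of the kernel of \<open>B\<close> is spanned by the rows of
  \<open>B\<close>; the coefficients of \<open>\<psi>\<close> in the rows are the entries of
  \<open>\<phi>\<close>.\<close>

lemma functional_factors:
  fixes B :: "'k::field mat"
  assumes B: "B \<in> carrier_mat m n" and \<psi>: "\<psi> \<in> carrier_vec n"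
    and ker: "\<And>x. x \<in> carrier_vec n \<Longrightarrow> B *\<^sub>v x = 0\<^sub>v m \<Longrightarrow> \<psi> \<bullet> x = 0"
  shows "\<exists>\<phi>\<in>carrier_vec m. transpose_mat B *\<^sub>v \<phi> = \<psi>"
proof -
  have "\<exists>c. \<forall>x\<in>carrier_vec n. \<psi> \<bullet> x = (\<Sum>i<m. c i * (row B i \<bullet> x))"
  proof (rule functional_in_span)
    fix x assume x: "x \<in> carrier_vec n" "\<And>i. i < m \<Longrightarrow> row B i \<bullet> x = 0"
    then have "B *\<^sub>v x = 0\<^sub>v m" using B by (intro eq_vecI) auto
    then show "\<psi> \<bullet> x = 0" using ker x by blast
  qed (use B \<psi> in auto)
  then obtain c where c: "\<forall>x\<in>carrier_vec n. \<psi> \<bullet> x = (\<Sum>i<m. c i * (row B i \<bullet> x))" by blast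
  have "transpose_mat B *\<^sub>v vec m c = \<psi>"
  proof (rule eq_vecI)
    fix j assume j: "j < dim_vec \<psi>"
    then have jn: "j < n" using \<psi> by simp
    have "\<psi> $ j = \<psi> \<bullet> unit_vec n j" using jn \<psi> by simp
    also have "\<dots> = (\<Sum>i<m. c i * (row B i \<bullet> unit_vec n j))" using c by simp
    also have "\<dots> = (\<Sum>i<m. c i * B $$ (i, j))"
      using B jn by (intro sum.cong) auto
    also have "\<dots> = (transpose_mat B *\<^sub>v vec m c) $ j"
      using B jn by (auto simp: scalar_prod_def lessThan_atLeast0 mult.commute intro!: sum.cong)
    finally show "(transpose_mat B *\<^sub>v vec m c) $ j = \<psi> $ j" by simp
  qed (use B \<psi> in auto)
  then show ?thesis by (intro bexI[of _ "vec m c"]) auto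
qed

text \<open>Under duality this turns monomorphisms into epimorphisms.\<close>

lemma transpose_surj_if_inj:
  fixes B :: "'k::field mat"
  assumes B: "B \<in> carrier_mat m n"
    and inj: "\<And>x y. x \<in> carrier_vec n \<Longrightarrow> y \<in> carrier_vec n \<Longrightarrow> B *\<^sub>v x = B *\<^sub>v y \<Longrightarrow> x = y"
    and \<psi>: "\<psi> \<in> carrier_vec n"
  shows "\<exists>\<phi>\<in>carrier_vec m. transpose_mat B *\<^sub>v \<phi> = \<psi>"
proof (rule functional_factors[OF B \<psi>])
  fix x assume x: "x \<in> carrier_vec n" "B *\<^sub>v x = 0\<^sub>v m"
  have "B *\<^sub>v 0\<^sub>v n = 0\<^sub>v m" using B by (intro eq_vecI) auto
  then have "x = 0\<^sub>v n" using inj x by simp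
  then show "\<psi> \<bullet> x = 0" using \<psi> by simp
qed

text \<open>Append \<open>z\<close> to \<open>B\<close> as a last column. A kernel vector of the
  enlarged matrix with nonzero last coordinate would exhibit \<open>z\<close> as an image vector of
  \<open>B\<close>. Hence the last coordinate vanishes on the kernel and factors through the
  enlarged matrix; the factor is the wanted functional.\<close>

lemma separating_functional:
  fixes B :: "'k::field mat"
  assumes B: "B \<in> carrier_mat m n" and z: "z \<in> carrier_vec m"
    and notin: "\<And>x. x \<in> carrier_vec n \<Longrightarrow> B *\<^sub>v x \<noteq> z"
  shows "\<exists>\<phi>\<in>carrier_vec m. \<phi> \<bullet> z = 1 \<and> transpose_mat B *\<^sub>v \<phi> = 0\<^sub>v n"
proof -
  define A where "A = mat m (Suc n) (\<lambda>(i, j). if j < n then B $$ (i, j) else z $ i)"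
  have A: "A \<in> carrier_mat m (Suc n)" by (simp add: A_def)
  have Ax: "A *\<^sub>v x = B *\<^sub>v vec n (\<lambda>j. x $ j) + x $ n \<cdot>\<^sub>v z" if "x \<in> carrier_vec (Suc n)" for x
    using that B z
    by (intro eq_vecI) (auto simp: A_def scalar_prod_def mult.commute intro!: sum.cong)
  have "\<exists>\<phi>\<in>carrier_vec m. transpose_mat A *\<^sub>v \<phi> = unit_vec (Suc n) n"
  proof (rule functional_factors[OF A])
    fix x assume x: "x \<in> carrier_vec (Suc n)" and 0: "A *\<^sub>v x = 0\<^sub>v m"
    have "x $ n = 0"
    proof (rule ccontr)
      assume nz: "x $ n \<noteq> 0"
      let ?y = "(- 1 / x $ n) \<cdot>\<^sub>v vec n (\<lambda>j. x $ j)"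
      have "B *\<^sub>v ?y = (- 1 / x $ n) \<cdot>\<^sub>v (B *\<^sub>v vec n (\<lambda>j. x $ j))"
        using B by (intro mult_mat_vec) auto
      also have "\<dots> = z"
      proof (rule eq_vecI)
        fix i assume i: "i < dim_vec z"
        then have im: "i < m" using z by simp
        have "(B *\<^sub>v vec n (\<lambda>j. x $ j) + x $ n \<cdot>\<^sub>v z) $ i = (0\<^sub>v m :: 'k vec) $ i" using 0 Ax[OF x] by simp
        then have "(B *\<^sub>v vec n (\<lambda>j. x $ j)) $ i = - (x $ n * z $ i)"
          using im B z by (simp add: add_eq_0_iff2)
        then show "((- 1 / x $ n) \<cdot>\<^sub>v (B *\<^sub>v vec n (\<lambda>j. x $ j))) $ i = z $ i"
          using im B z nz by simp
      qed (use B z in auto)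
      finally show False using notin[of ?y] by simp
    qed
    then show "unit_vec (Suc n) n \<bullet> x = 0" using x by simp
  qed simp
  then obtain \<phi> where \<phi>: "\<phi> \<in> carrier_vec m" "transpose_mat A *\<^sub>v \<phi> = unit_vec (Suc n) n" by blast
  have e: "col A j \<bullet> \<phi> = unit_vec (Suc n) n $ j" if "j < Suc n" for j
    using arg_cong[OF \<phi>(2), of "\<lambda>v. v $ j"] that A by simp
  have "col A n = z" using z by (intro eq_vecI) (auto simp: A_def)
  then have "z \<bullet> \<phi> = 1" using e[of n] by simp
  then have 1: "\<phi> \<bullet> z = 1" using comm_scalar_prod[OF z \<phi>(1)] by simp
  have "transpose_mat B *\<^sub>v \<phi> = 0\<^sub>v n"
  proof (rule eq_vecI)
    fix j assume "j < dim_vec (0\<^sub>v n :: 'k vec)"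
    then have j: "j < n" by simp
    then have "col A j = col B j" using B by (intro eq_vecI) (auto simp: A_def)
    then show "(transpose_mat B *\<^sub>v \<phi>) $ j = 0\<^sub>v n $ j" using e[of j] j B by simp
  qed (use B in auto)
  with 1 \<phi> show ?thesis by blast
qed

section \<open>Block matrices and the splitting of idempotents\<close>

definition hcat :: "'k::field mat \<Rightarrow> 'k mat \<Rightarrow> 'k mat" where
  "hcat A B = four_block_mat A B (0\<^sub>m 0 (dim_col A)) (0\<^sub>m 0 (dim_col B))"

definition vcat :: "'k::field mat \<Rightarrow> 'k mat \<Rightarrow> 'k mat" where
  "vcat A B = four_block_mat A (0\<^sub>m (dim_row A) 0) B (0\<^sub>m (dim_row B) 0)"

text \<open>Blocks without rows or columns make every product below an instance of
  \<open>mult_four_block_mat\<close>; this rule removes the empty borders again.\<close>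

lemma four_block_thin_mat [simp]:
  "A \<in> carrier_mat m n \<Longrightarrow> four_block_mat A (0\<^sub>m m 0) (0\<^sub>m 0 n) (0\<^sub>m 0 0) = A"
  by (intro eq_matI) auto

lemma hcat_carrier [simp]:
  "A \<in> carrier_mat m n1 \<Longrightarrow> B \<in> carrier_mat m n2 \<Longrightarrow> hcat A B \<in> carrier_mat m (n1 + n2)"
  by (auto simp: hcat_def)

lemma vcat_carrier [simp]:
  "A \<in> carrier_mat m1 n \<Longrightarrow> B \<in> carrier_mat m2 n \<Longrightarrow> vcat A B \<in> carrier_mat (m1 + m2) n"
  by (auto simp: vcat_def)

lemma hcat_mult_vcat:
  assumes "B1 \<in> carrier_mat m r1" "B2 \<in> carrier_mat m r2" "C1 \<in> carrier_mat r1 n" "C2 \<in> carrier_mat r2 n"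
  shows "hcat B1 B2 * vcat C1 C2 = B1 * C1 + B2 * C2"
proof -
  have "hcat B1 B2 * vcat C1 C2 = four_block_mat (B1 * C1 + B2 * C2) (0\<^sub>m m 0) (0\<^sub>m 0 n) (0\<^sub>m 0 0)"
    unfolding hcat_def vcat_def
    by (subst mult_four_block_mat[of _ m r1 _ r2 _ 0 _ _ n _ 0]) (use assms in auto)
  also have "\<dots> = B1 * C1 + B2 * C2" using assms by (intro four_block_thin_mat) auto
  finally show ?thesis .
qed

lemma vcat_mult_hcat:
  assumes "B1 \<in> carrier_mat n r1" "B2 \<in> carrier_mat n r2" "C1 \<in> carrier_mat s1 n" "C2 \<in> carrier_mat s2 n"
  shows "vcat C1 C2 * hcat B1 B2 = four_block_mat (C1 * B1) (C1 * B2) (C2 * B1) (C2 * B2)"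
  unfolding hcat_def vcat_def
  by (subst mult_four_block_mat[of _ s1 n _ 0 _ s2 _ _ r1 _ r2]) (use assms in auto)

lemma vcat_mult:
  assumes "C1 \<in> carrier_mat r1 m" "C2 \<in> carrier_mat r2 m" "M \<in> carrier_mat m n"
  shows "vcat C1 C2 * M = vcat (C1 * M) (C2 * M)"
proof -
  have "vcat C1 C2 * M = vcat C1 C2 * four_block_mat M (0\<^sub>m m 0) (0\<^sub>m 0 n) (0\<^sub>m 0 0)"
    using assms by simp
  also have "\<dots> = vcat (C1 * M) (C2 * M)"
    unfolding vcat_def
    by (subst mult_four_block_mat[of _ r1 m _ 0 _ r2 _ _ n _ 0]) (use assms in auto)
  finally show ?thesis .
qed

lemma mult_hcat:
  assumes "M \<in> carrier_mat n m" "B1 \<in> carrier_mat m r1" "B2 \<in> carrier_mat m r2"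
  shows "M * hcat B1 B2 = hcat (M * B1) (M * B2)"
proof -
  have "M * hcat B1 B2 = four_block_mat M (0\<^sub>m n 0) (0\<^sub>m 0 m) (0\<^sub>m 0 0) * hcat B1 B2"
    using assms by simp
  also have "\<dots> = hcat (M * B1) (M * B2)"
    unfolding hcat_def
    by (subst mult_four_block_mat[of _ n m _ 0 _ 0 _ _ r1 _ r2]) (use assms in auto)
  finally show ?thesis .
qed

lemma diag_mult_vcat:
  assumes "C1 \<in> carrier_mat r1 n" "C2 \<in> carrier_mat r2 n"
    "A \<in> carrier_mat s1 r1" "D \<in> carrier_mat s2 r2"
  shows "four_block_mat A (0\<^sub>m s1 r2) (0\<^sub>m s2 r1) D * vcat C1 C2 = vcat (A * C1) (D * C2)"
  unfolding vcat_def
  by (subst mult_four_block_mat[of _ s1 r1 _ r2 _ s2 _ _ n _ 0]) (use assms in auto)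

lemma hcat_mult_diag:
  assumes "B1 \<in> carrier_mat n r1" "B2 \<in> carrier_mat n r2"
    "A \<in> carrier_mat r1 s1" "D \<in> carrier_mat r2 s2"
  shows "hcat B1 B2 * four_block_mat A (0\<^sub>m r1 s2) (0\<^sub>m r2 s1) D = hcat (B1 * A) (B2 * D)"
  unfolding hcat_def
  by (subst mult_four_block_mat[of _ n r1 _ r2 _ 0 _ _ s1 _ s2]) (use assms in auto)

text \<open>Induction on the number of nonzero rows, splitting off a piece \<open>X * \<Phi>\<close>
  of rank one. The rest \<open>F\<close> is again idempotent with \<open>F * X = 0\<close> and
  \<open>\<Phi> * F = 0\<close>, so its factors can be extended by \<open>X\<close> as a new column
  and \<open>\<Phi>\<close> as a new row.\<close>

lemma idempotent_splits:
  fixes E :: "'k::field mat"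
  assumes "E \<in> carrier_mat n n" and "E * E = E"
  shows "\<exists>r. \<exists>B\<in>carrier_mat n r. \<exists>C\<in>carrier_mat r n. B * C = E \<and> C * B = 1\<^sub>m r"
  using assms
proof (induction "card {i. i < n \<and> (\<exists>j<n. E $$ (i, j) \<noteq> 0)}" arbitrary: E rule: less_induct)
  case less
  note E = less.prems(1) and idem = less.prems(2)
  show ?case
  proof (cases "E = 0\<^sub>m n n")
    case True
    then have "0\<^sub>m n 0 * 0\<^sub>m 0 n = E \<and> 0\<^sub>m 0 n * 0\<^sub>m n 0 = (1\<^sub>m 0 :: 'k mat)"
      by auto
    then show ?thesis by (metis zero_carrier_mat)
  next
    case False
    then obtain i j where ij: "i < n" "j < n" "E $$ (i, j) \<noteq> 0"
      using E by (metis eq_matI carrier_matD index_zero_mat)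
    have ee: "(\<Sum>k\<in>{0..<n}. E $$ (a, k) * E $$ (k, b)) = E $$ (a, b)" if "a < n" "b < n" for a b
      using arg_cong[OF idem, of "\<lambda>M. M $$ (a, b)"] that E by (simp add: scalar_prod_def)
    \<comment> \<open>A column of \<open>E\<close> is fixed by \<open>E\<close>, and so is a row
      under multiplication from the right. Dividing by the pivot gives
      \<open>\<Phi> * X = 1\<close>: this is the equation \<open>E * E = E\<close> at the entry (i,
      j).\<close>
    define X where "X = mat n 1 (\<lambda>(a, b). E $$ (a, j))"
    define \<Phi> where "\<Phi> = mat 1 n (\<lambda>(a, b). E $$ (i, b) / E $$ (i, j))"
    define F where "F = E - X * \<Phi>"
    have X: "X \<in> carrier_mat n 1" and \<Phi>: "\<Phi> \<in> carrier_mat 1 n" by (auto simp: X_def \<Phi>_def)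
    have F: "F \<in> carrier_mat n n" using E X \<Phi> by (auto simp: F_def)
    have EX: "E * X = X"
      using E ij ee by (intro eq_matI) (auto simp: X_def scalar_prod_def)
    have \<Phi>E: "\<Phi> * E = \<Phi>"
      using E ij ee by (intro eq_matI) (auto simp: \<Phi>_def scalar_prod_def sum_divide_distrib[symmetric])
    have \<Phi>X: "\<Phi> * X = 1\<^sub>m 1"
      using E ij ee by (intro eq_matI)
        (auto simp: \<Phi>_def X_def scalar_prod_def sum_divide_distrib[symmetric])
    have X\<Phi>X: "X * (\<Phi> * X) = X" "\<Phi> * (X * \<Phi>) = \<Phi>"
      using \<Phi>X X \<Phi> assoc_mult_mat[OF \<Phi> X \<Phi>] by auto
    have FX: "F * X = 0\<^sub>m n 1"
      using E X \<Phi> EX X\<Phi>X by (simp add: F_def minus_mult_distrib_mat[of _ n n])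
    have \<Phi>F: "\<Phi> * F = 0\<^sub>m 1 n"
      using E X \<Phi> \<Phi>E X\<Phi>X by (simp add: F_def mult_minus_distrib_mat[of _ 1 n])
    have FE: "F * E = F"
      using E X \<Phi> idem \<Phi>E by (simp add: F_def minus_mult_distrib_mat[of _ n n])
    have "F * F = F * E - F * (X * \<Phi>)"
      using mult_minus_distrib_mat[OF F E, of "X * \<Phi>"] X \<Phi> by (simp flip: F_def)
    also have "F * (X * \<Phi>) = 0\<^sub>m n n"
      using FX \<Phi> assoc_mult_mat[OF F X \<Phi>] by simp
    finally have FF: "F * F = F" using FE F by simp
    have Fe: "F $$ (a, b) = E $$ (a, b) - E $$ (a, j) * E $$ (i, b) / E $$ (i, j)" if "a < n" "b < n" for a b
      using that E by (simp add: F_def X_def \<Phi>_def scalar_prod_def)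
    \<comment> \<open>Row \<open>i\<close> becomes zero, and zero rows of \<open>E\<close> stay
      zero.\<close>
    have "{a. a < n \<and> (\<exists>b<n. F $$ (a, b) \<noteq> 0)} \<subset> {a. a < n \<and> (\<exists>b<n. E $$ (a, b) \<noteq> 0)}"
    proof
      show "{a. a < n \<and> (\<exists>b<n. F $$ (a, b) \<noteq> 0)} \<subseteq> {a. a < n \<and> (\<exists>b<n. E $$ (a, b) \<noteq> 0)}"
      proof safe
        fix a b assume ab: "a < n" "b < n" "F $$ (a, b) \<noteq> 0"
        then have "E $$ (a, b) \<noteq> 0 \<or> E $$ (a, j) \<noteq> 0" using Fe by auto
        then show "\<exists>b<n. E $$ (a, b) \<noteq> 0" using ab ij by blast
      qed
      have "i \<notin> {a. a < n \<and> (\<exists>b<n. F $$ (a, b) \<noteq> 0)}" using ij Fe by auto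
      then show "{a. a < n \<and> (\<exists>b<n. F $$ (a, b) \<noteq> 0)} \<noteq> {a. a < n \<and> (\<exists>b<n. E $$ (a, b) \<noteq> 0)}"
        using ij by blast
    qed
    then have "card {a. a < n \<and> (\<exists>b<n. F $$ (a, b) \<noteq> 0)} < card {a. a < n \<and> (\<exists>b<n. E $$ (a, b) \<noteq> 0)}"
      by (intro psubset_card_mono) auto
    from less.hyps[OF this F FF] obtain r B C where
      B: "B \<in> carrier_mat n r" and C: "C \<in> carrier_mat r n" and BC: "B * C = F" and CB: "C * B = 1\<^sub>m r"
      by blast
    \<comment> \<open>Inserting \<open>C * B = 1\<close> exposes the factor
      \<open>B * C = F\<close>, which kills \<open>X\<close>.\<close>
    have "C * X = C * B * (C * X)" using C X CB by simp
    also have "\<dots> = C * (F * X)" using B C X by (simp add: mat_assoc BC[symmetric])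
    also have "\<dots> = 0\<^sub>m r 1" using C FX by simp
    finally have CX: "C * X = 0\<^sub>m r 1" .
    have "\<Phi> * B = \<Phi> * B * (C * B)" using B \<Phi> CB by simp
    also have "\<dots> = \<Phi> * F * B" using B C \<Phi> F by (simp add: mat_assoc BC[symmetric])
    also have "\<dots> = 0\<^sub>m 1 r" using B \<Phi>F by simp
    finally have \<Phi>B: "\<Phi> * B = 0\<^sub>m 1 r" .
    have 1: "hcat B X * vcat C \<Phi> = E"
    proof -
      have "hcat B X * vcat C \<Phi> = F + X * \<Phi>" using hcat_mult_vcat[OF B X C \<Phi>] BC by simp
      also have "\<dots> = E" using E X \<Phi> by (intro eq_matI) (auto simp: F_def)
      finally show ?thesis .
    qed
    have 2: "vcat C \<Phi> * hcat B X = 1\<^sub>m (r + 1)"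
      using vcat_mult_hcat[OF B X C \<Phi>] CB CX \<Phi>B \<Phi>X by simp
    show ?thesis
      using 1 2 hcat_carrier[OF B X] vcat_carrier[OF C \<Phi>] by blast
  qed
qed

section \<open>Representations\<close>

lemma is_rep_J2D:
  assumes "is_rep_J2 Q M" "a \<in> arrs Q"
  shows "rmap M a \<in> carrier_mat (rdim M (tgt Q a)) (rdim M (src Q a))"
  using assms by (auto simp: is_rep_J2_def)

lemma is_homD:
  assumes "is_hom Q M N f"
  shows "v \<in> verts Q \<Longrightarrow> f v \<in> carrier_mat (rdim N v) (rdim M v)"
    and "a \<in> arrs Q \<Longrightarrow> f (tgt Q a) * rmap M a = rmap N a * f (src Q a)"
  using assms by (auto simp: is_hom_def)

lemma wf_quiverD:
  assumes "wf_quiver Q" "a \<in> arrs Q"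
  shows "src Q a \<in> verts Q" "tgt Q a \<in> verts Q"
  using assms by (auto simp: wf_quiver_def)

lemma rep_apply_twice:
  assumes M: "is_rep_J2 Q M" and a: "a \<in> arrs Q" and b: "b \<in> arrs Q" and ba: "src Q b = tgt Q a"
    and x: "x \<in> carrier_vec (rdim M (src Q a))"
  shows "rmap M b *\<^sub>v (rmap M a *\<^sub>v x) = 0\<^sub>v (rdim M (tgt Q b))"
proof -
  note carr = is_rep_J2D[OF M a] is_rep_J2D[OF M b]
  have "rmap M b *\<^sub>v (rmap M a *\<^sub>v x) = (rmap M b * rmap M a) *\<^sub>v x"
    using carr x ba by simp
  also have "\<dots> = 0\<^sub>v (rdim M (tgt Q b))" using M a b ba x by (simp add: is_rep_J2_def)
  finally show ?thesis .
qed

lemma is_hom_comp: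
  assumes Q: "wf_quiver Q" and M: "is_rep_J2 Q M" and N: "is_rep_J2 Q N" and P: "is_rep_J2 Q P"
    and f: "is_hom Q M N f" and g: "is_hom Q N P g"
  shows "is_hom Q M P (\<lambda>v. g v * f v)"
proof -
  have "g (tgt Q a) * f (tgt Q a) * rmap M a = rmap P a * (g (src Q a) * f (src Q a))"
    if a: "a \<in> arrs Q" for a
  proof -
    note w = wf_quiverD[OF Q a]
    note carr = is_rep_J2D[OF M a] is_rep_J2D[OF N a] is_rep_J2D[OF P a]
      is_homD(1)[OF f w(1)] is_homD(1)[OF f w(2)] is_homD(1)[OF g w(1)] is_homD(1)[OF g w(2)]
    note dims = carr[THEN carrier_matD(1)] carr[THEN carrier_matD(2)]
    have "g (tgt Q a) * f (tgt Q a) * rmap M a = g (tgt Q a) * rmap N a * f (src Q a)"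
      using dims is_homD(2)[OF f a] by (simp add: mat_assoc)
    also have "\<dots> = rmap P a * (g (src Q a) * f (src Q a))"
      unfolding is_homD(2)[OF g a] using dims by (simp add: mat_assoc)
    finally show ?thesis .
  qed
  then show ?thesis
    using is_homD(1)[OF f] is_homD(1)[OF g] by (auto simp: is_hom_def intro!: mult_carrier_mat)
qed

lemma is_hom_id:
  assumes M: "is_rep_J2 Q M"
  shows "is_hom Q M M (\<lambda>v. 1\<^sub>m (rdim M v))"
  using left_mult_one_mat[OF is_rep_J2D[OF M]] right_mult_one_mat[OF is_rep_J2D[OF M]]
  by (auto simp: is_hom_def)

text \<open>This is the image of \<open>e\<close> in the coordinates of a splitting. A product of
  two arrows contains \<open>B * C = e\<close> in the middle; moving \<open>e\<close> past the first
  arrow leaves the two arrows of \<open>M\<close> adjacent, and their product is zero.\<close>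

lemma is_rep_image_idempotent:
  assumes Q: "wf_quiver Q" and M: "is_rep_J2 Q M" and e: "is_hom Q M M e"
    and B: "\<And>v. v \<in> verts Q \<Longrightarrow> B v \<in> carrier_mat (rdim M v) (r v)"
    and C: "\<And>v. v \<in> verts Q \<Longrightarrow> C v \<in> carrier_mat (r v) (rdim M v)"
    and BC: "\<And>v. v \<in> verts Q \<Longrightarrow> B v * C v = e v"
  shows "is_rep_J2 Q \<lparr>rdim = r, rmap = \<lambda>a. C (tgt Q a) * rmap M a * B (src Q a)\<rparr>"
proof -
  have "C (tgt Q b) * rmap M b * B (src Q b) * (C (tgt Q a) * rmap M a * B (src Q a))
      = 0\<^sub>m (r (tgt Q b)) (r (src Q a))"
    if a: "a \<in> arrs Q" and b: "b \<in> arrs Q" and ba: "src Q b = tgt Q a" for a b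
  proof -
    note w = wf_quiverD[OF Q a] wf_quiverD[OF Q b]
    note carr = is_rep_J2D[OF M a] is_rep_J2D[OF M b, unfolded ba]
      w[THEN B] w[THEN C] w[THEN is_homD(1)[OF e]]
    note dims = carr[THEN carrier_matD(1)] carr[THEN carrier_matD(2)]
    have "C (tgt Q b) * rmap M b * B (src Q b) * (C (tgt Q a) * rmap M a * B (src Q a))
        = C (tgt Q b) * rmap M b * (B (tgt Q a) * C (tgt Q a) * rmap M a) * B (src Q a)"
      using dims ba by (simp add: mat_assoc)
    also have "B (tgt Q a) * C (tgt Q a) * rmap M a = rmap M a * e (src Q a)"
      using BC[OF w(2)] is_homD(2)[OF e a] by simp
    also have "C (tgt Q b) * rmap M b * (rmap M a * e (src Q a)) * B (src Q a)
        = C (tgt Q b) * (rmap M b * rmap M a) * e (src Q a) * B (src Q a)"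
      using dims ba by (simp add: mat_assoc)
    also have "rmap M b * rmap M a = 0\<^sub>m (rdim M (tgt Q b)) (rdim M (src Q a))"
      using M a b ba by (simp add: is_rep_J2_def)
    finally show ?thesis using carr by simp
  qed
  moreover have "C (tgt Q a) * rmap M a * B (src Q a) \<in> carrier_mat (r (tgt Q a)) (r (src Q a))"
    if a: "a \<in> arrs Q" for a
    using wf_quiverD[OF Q a] is_rep_J2D[OF M a] B C by (meson mult_carrier_mat)
  ultimately show ?thesis by (auto simp: is_rep_J2_def)
qed

text \<open>Otherwise M would be the direct sum of the images of e and 1 - e, both nonzero. The two
  splittings at each vertex, stacked, give the isomorphism and its inverse.\<close>

lemma indecomposable_idempotent:
  assumes Q: "wf_quiver Q" and M: "is_rep_J2 Q M" and ind: "indecomposable Q M"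
    and e: "is_hom Q M M e" and idem: "\<And>v. v \<in> verts Q \<Longrightarrow> e v * e v = e v"
    and nz: "\<exists>v\<in>verts Q. e v \<noteq> 0\<^sub>m (rdim M v) (rdim M v)"
  shows "\<forall>v\<in>verts Q. e v = 1\<^sub>m (rdim M v)"
proof (rule ccontr)
  assume n1: "\<not> (\<forall>v\<in>verts Q. e v = 1\<^sub>m (rdim M v))"
  note ec = is_homD(1)[OF e]
  define d where "d v = 1\<^sub>m (rdim M v) - e v" for v
  have d: "is_hom Q M M d"
  proof -
    have "d (tgt Q a) * rmap M a = rmap M a * d (src Q a)" if a: "a \<in> arrs Q" for a
      using wf_quiverD[OF Q a, THEN ec] is_rep_J2D[OF M a] is_homD(2)[OF e a]
        minus_mult_distrib_mat[OF one_carrier_mat ec[OF wf_quiverD(2)[OF Q a]] is_rep_J2D[OF M a]]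
        mult_minus_distrib_mat[OF is_rep_J2D[OF M a] one_carrier_mat ec[OF wf_quiverD(1)[OF Q a]]]
      by (simp add: d_def)
    then show ?thesis using ec by (auto simp: is_hom_def d_def intro!: minus_carrier_mat)
  qed
  note dc = is_homD(1)[OF d]
  have ed: "e v * d v = 0\<^sub>m (rdim M v) (rdim M v)" if v: "v \<in> verts Q" for v
    using ec[OF v] idem[OF v] mult_minus_distrib_mat[OF ec[OF v] one_carrier_mat ec[OF v]] by (simp add: d_def)
  have de: "d v * e v = 0\<^sub>m (rdim M v) (rdim M v)" if v: "v \<in> verts Q" for v
    using ec[OF v] idem[OF v] minus_mult_distrib_mat[OF one_carrier_mat ec[OF v] ec[OF v]] by (simp add: d_def)
  have dd: "d v * d v = d v" if v: "v \<in> verts Q" for v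
  proof -
    have "d v * d v = d v * 1\<^sub>m (rdim M v) - d v * e v"
      using mult_minus_distrib_mat[OF dc[OF v] one_carrier_mat ec[OF v]] by (simp flip: d_def)
    then show ?thesis using dc[OF v] de[OF v] by simp
  qed
  obtain r1 B1 C1 where s1: "\<And>v. v \<in> verts Q \<Longrightarrow> B1 v \<in> carrier_mat (rdim M v) (r1 v)"
    "\<And>v. v \<in> verts Q \<Longrightarrow> C1 v \<in> carrier_mat (r1 v) (rdim M v)"
    "\<And>v. v \<in> verts Q \<Longrightarrow> B1 v * C1 v = e v" "\<And>v. v \<in> verts Q \<Longrightarrow> C1 v * B1 v = 1\<^sub>m (r1 v)"
    using idempotent_splits[OF ec idem] by metis
  obtain r2 B2 C2 where s2: "\<And>v. v \<in> verts Q \<Longrightarrow> B2 v \<in> carrier_mat (rdim M v) (r2 v)"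
    "\<And>v. v \<in> verts Q \<Longrightarrow> C2 v \<in> carrier_mat (r2 v) (rdim M v)"
    "\<And>v. v \<in> verts Q \<Longrightarrow> B2 v * C2 v = d v" "\<And>v. v \<in> verts Q \<Longrightarrow> C2 v * B2 v = 1\<^sub>m (r2 v)"
    using idempotent_splits[OF dc dd] by metis
  define N1 where "N1 = \<lparr>rdim = r1, rmap = \<lambda>a. C1 (tgt Q a) * rmap M a * B1 (src Q a)\<rparr>"
  define N2 where "N2 = \<lparr>rdim = r2, rmap = \<lambda>a. C2 (tgt Q a) * rmap M a * B2 (src Q a)\<rparr>"
  have N1: "is_rep_J2 Q N1" unfolding N1_def by (rule is_rep_image_idempotent[OF Q M e s1(1-3)])
  have N2: "is_rep_J2 Q N2" unfolding N2_def by (rule is_rep_image_idempotent[OF Q M d s2(1-3)])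
  have nz1: "rep_nonzero Q N1"
  proof -
    obtain v where v: "v \<in> verts Q" "e v \<noteq> 0\<^sub>m (rdim M v) (rdim M v)" using nz by blast
    have "r1 v \<noteq> 0"
    proof
      assume "r1 v = 0"
      then have "B1 v * C1 v = 0\<^sub>m (rdim M v) (rdim M v)"
        using s1(1,2)[OF v(1)] by (intro eq_matI) (auto simp: scalar_prod_def)
      then show False using s1(3) v by simp
    qed
    then show ?thesis using v by (auto simp: rep_nonzero_def N1_def)
  qed
  have nz2: "rep_nonzero Q N2"
  proof -
    obtain v where v: "v \<in> verts Q" "e v \<noteq> 1\<^sub>m (rdim M v)" using n1 by blast
    have "r2 v \<noteq> 0"
    proof
      assume "r2 v = 0"
      then have "B2 v * C2 v = 0\<^sub>m (rdim M v) (rdim M v)"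
        using s2(1,2)[OF v(1)] by (intro eq_matI) (auto simp: scalar_prod_def)
      then have "d v = 0\<^sub>m (rdim M v) (rdim M v)" using s2(3) v by simp
      moreover have "e v = 1\<^sub>m (rdim M v) - d v"
        using ec[OF v(1)] by (intro eq_matI) (auto simp: d_def)
      ultimately show False using v by simp
    qed
    then show ?thesis using v by (auto simp: rep_nonzero_def N2_def)
  qed
  \<comment> \<open>Surrounding the product by identities \<open>C * B\<close> exposes
    \<open>e * d = 0\<close>; likewise for \<open>d * e\<close> below.\<close>
  have CB12: "C1 v * B2 v = 0\<^sub>m (r1 v) (r2 v)" if v: "v \<in> verts Q" for v
  proof -
    note c = s1(1,2)[OF v] s2(1,2)[OF v]
    note dims = c[THEN carrier_matD(1)] c[THEN carrier_matD(2)]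
    have "C1 v * B2 v = (C1 v * B1 v) * (C1 v * B2 v) * (C2 v * B2 v)"
      using c s1(4)[OF v] s2(4)[OF v] by simp
    also have "\<dots> = C1 v * ((B1 v * C1 v) * (B2 v * C2 v)) * B2 v" using dims by (simp add: mat_assoc)
    also have "\<dots> = 0\<^sub>m (r1 v) (r2 v)" using c s1(3)[OF v] s2(3)[OF v] ed[OF v] by simp
    finally show ?thesis .
  qed
  have CB21: "C2 v * B1 v = 0\<^sub>m (r2 v) (r1 v)" if v: "v \<in> verts Q" for v
  proof -
    note c = s1(1,2)[OF v] s2(1,2)[OF v]
    note dims = c[THEN carrier_matD(1)] c[THEN carrier_matD(2)]
    have "C2 v * B1 v = (C2 v * B2 v) * (C2 v * B1 v) * (C1 v * B1 v)"
      using c s1(4)[OF v] s2(4)[OF v] by simp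
    also have "\<dots> = C2 v * ((B2 v * C2 v) * (B1 v * C1 v)) * B1 v" using dims by (simp add: mat_assoc)
    also have "\<dots> = 0\<^sub>m (r2 v) (r1 v)" using c s1(3)[OF v] s2(3)[OF v] de[OF v] by simp
    finally show ?thesis .
  qed
  let ?N = "rep_dsum Q N1 N2"
  define f where "f v = vcat (C1 v) (C2 v)" for v
  define g where "g v = hcat (B1 v) (B2 v)" for v
  have "is_hom Q M ?N f"
  proof -
    have "f (tgt Q a) * rmap M a = rmap ?N a * f (src Q a)" if a: "a \<in> arrs Q" for a
    proof -
      let ?s = "src Q a" and ?t = "tgt Q a"
      note w = wf_quiverD[OF Q a]
      note c = s1(1,2)[OF w(1)] s1(1,2)[OF w(2)] s2(1,2)[OF w(1)] s2(1,2)[OF w(2)] is_rep_J2D[OF M a]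
      note dims = c[THEN carrier_matD(1)] c[THEN carrier_matD(2)]
      note k = ec[OF w(1)] ec[OF w(2)] dc[OF w(1)] dc[OF w(2)]
      have 1: "C1 ?t * rmap M a * B1 ?s * C1 ?s = C1 ?t * rmap M a"
      proof -
        have "C1 ?t * rmap M a * B1 ?s * C1 ?s = C1 ?t * (rmap M a * (B1 ?s * C1 ?s))"
          using dims by (simp add: mat_assoc)
        also have "\<dots> = C1 ?t * (B1 ?t * C1 ?t * rmap M a)"
          using is_homD(2)[OF e a] s1(3)[OF w(1)] s1(3)[OF w(2)] by simp
        also have "\<dots> = (C1 ?t * B1 ?t) * (C1 ?t * rmap M a)" using dims by (simp add: mat_assoc)
        finally show ?thesis using s1(4)[OF w(2)] c by simp
      qed
      have 2: "C2 ?t * rmap M a * B2 ?s * C2 ?s = C2 ?t * rmap M a"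
      proof -
        have "C2 ?t * rmap M a * B2 ?s * C2 ?s = C2 ?t * (rmap M a * (B2 ?s * C2 ?s))"
          using dims by (simp add: mat_assoc)
        also have "\<dots> = C2 ?t * (B2 ?t * C2 ?t * rmap M a)"
          using is_homD(2)[OF d a] s2(3)[OF w(1)] s2(3)[OF w(2)] by simp
        also have "\<dots> = (C2 ?t * B2 ?t) * (C2 ?t * rmap M a)" using dims by (simp add: mat_assoc)
        finally show ?thesis using s2(4)[OF w(2)] c by simp
      qed
      have "rmap ?N a * f ?s = vcat (C1 ?t * rmap M a * B1 ?s * C1 ?s) (C2 ?t * rmap M a * B2 ?s * C2 ?s)"
        using c unfolding f_def by (simp add: rep_dsum_def N1_def N2_def diag_mult_vcat[of _ "r1 ?s" "rdim M ?s" _ "r2 ?s"])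
      also have "\<dots> = f ?t * rmap M a"
        using c unfolding 1 2 f_def by (simp add: vcat_mult[of _ "r1 ?t" "rdim M ?t" _ "r2 ?t"])
      finally show ?thesis by simp
    qed
    then show ?thesis using s1(2) s2(2) by (auto simp: is_hom_def rep_dsum_def N1_def N2_def f_def)
  qed
  moreover have "is_hom Q ?N M g"
  proof -
    have "g (tgt Q a) * rmap ?N a = rmap M a * g (src Q a)" if a: "a \<in> arrs Q" for a
    proof -
      let ?s = "src Q a" and ?t = "tgt Q a"
      note w = wf_quiverD[OF Q a]
      note c = s1(1,2)[OF w(1)] s1(1,2)[OF w(2)] s2(1,2)[OF w(1)] s2(1,2)[OF w(2)] is_rep_J2D[OF M a]
      note dims = c[THEN carrier_matD(1)] c[THEN carrier_matD(2)]
      have 1: "B1 ?t * (C1 ?t * rmap M a * B1 ?s) = rmap M a * B1 ?s"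
      proof -
        have "B1 ?t * (C1 ?t * rmap M a * B1 ?s) = (B1 ?t * C1 ?t * rmap M a) * B1 ?s"
          using dims by (simp add: mat_assoc)
        also have "\<dots> = rmap M a * (B1 ?s * C1 ?s) * B1 ?s"
          using is_homD(2)[OF e a] s1(3)[OF w(1)] s1(3)[OF w(2)] by simp
        also have "\<dots> = rmap M a * B1 ?s * (C1 ?s * B1 ?s)" using dims by (simp add: mat_assoc)
        finally show ?thesis using s1(4)[OF w(1)] c by simp
      qed
      have 2: "B2 ?t * (C2 ?t * rmap M a * B2 ?s) = rmap M a * B2 ?s"
      proof -
        have "B2 ?t * (C2 ?t * rmap M a * B2 ?s) = (B2 ?t * C2 ?t * rmap M a) * B2 ?s"
          using dims by (simp add: mat_assoc)
        also have "\<dots> = rmap M a * (B2 ?s * C2 ?s) * B2 ?s"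
          using is_homD(2)[OF d a] s2(3)[OF w(1)] s2(3)[OF w(2)] by simp
        also have "\<dots> = rmap M a * B2 ?s * (C2 ?s * B2 ?s)" using dims by (simp add: mat_assoc)
        finally show ?thesis using s2(4)[OF w(1)] c by simp
      qed
      have "g ?t * rmap ?N a = hcat (B1 ?t * (C1 ?t * rmap M a * B1 ?s)) (B2 ?t * (C2 ?t * rmap M a * B2 ?s))"
        using c unfolding g_def
        by (simp add: rep_dsum_def N1_def N2_def hcat_mult_diag[of _ "rdim M ?t" "r1 ?t" _ "r2 ?t"])
      also have "\<dots> = rmap M a * g ?s"
        using c unfolding 1 2 g_def by (simp add: mult_hcat[of _ "rdim M ?t" "rdim M ?s"])
      finally show ?thesis by simp
    qed
    then show ?thesis using s1(1) s2(1) by (auto simp: is_hom_def rep_dsum_def N1_def N2_def g_def)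
  qed
  moreover have "g v * f v = 1\<^sub>m (rdim M v) \<and> f v * g v = 1\<^sub>m (rdim ?N v)" if v: "v \<in> verts Q" for v
  proof
    have "g v * f v = e v + d v"
      unfolding f_def g_def using hcat_mult_vcat[OF s1(1)[OF v] s2(1)[OF v] s1(2)[OF v] s2(2)[OF v]]
        s1(3)[OF v] s2(3)[OF v] by simp
    also have "\<dots> = 1\<^sub>m (rdim M v)" using ec[OF v] by (intro eq_matI) (auto simp: d_def)
    finally show "g v * f v = 1\<^sub>m (rdim M v)" .
    show "f v * g v = 1\<^sub>m (rdim ?N v)"
      unfolding f_def g_def using vcat_mult_hcat[OF s1(1)[OF v] s2(1)[OF v] s1(2)[OF v] s2(2)[OF v]]
        s1(4)[OF v] s2(4)[OF v] CB12[OF v] CB21[OF v] by (simp add: rep_dsum_def N1_def N2_def)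
  qed
  ultimately have "rep_iso Q M ?N" by (auto simp: rep_iso_def)
  then show False using ind N1 N2 nz1 nz2 by (auto simp: indecomposable_def)
qed

section \<open>Free generators and projectivity\<close>

text \<open>The universal property of the projective at \<open>v\<close>, which spares us a matrix model of it.\<close>
definition free_on :: "('v, 'a) quiver \<Rightarrow> ('v, 'a, 'k::field) rep \<Rightarrow> 'v \<Rightarrow> 'k vec \<Rightarrow> bool" where
  "free_on Q M v x \<longleftrightarrow> x \<in> carrier_vec (rdim M v)
    \<and> (\<forall>N. \<forall>n\<in>carrier_vec (rdim N v). is_rep_J2 Q N \<longrightarrow> (\<exists>h. is_hom Q M N h \<and> h v *\<^sub>v x = n))
    \<and> (\<forall>N h h'. is_rep_J2 Q N \<and> is_hom Q M N h \<and> is_hom Q M N h' \<and> h v *\<^sub>v x = h' v *\<^sub>v x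
        \<longrightarrow> (\<forall>w\<in>verts Q. h w = h' w))"

text \<open>It is enough to lift the image of the generator: uniqueness in the universal property
  turns agreement at \<open>x\<close> into equality of homomorphisms.\<close>

lemma free_on_projective:
  assumes Q: "wf_quiver Q" and v: "v \<in> verts Q" and P: "is_rep_J2 Q P" and free: "free_on Q P v x"
  shows "projective_rep Q P"
  unfolding projective_rep_def
proof (intro allI impI, elim conjE)
  fix M N g f
  assume M: "is_rep_J2 Q M" and N: "is_rep_J2 Q N" and g: "is_epi Q M N g" and f: "is_hom Q P N f"
  have gh: "is_hom Q M N g" using g by (simp add: is_epi_def)
  have x: "x \<in> carrier_vec (rdim P v)" using free by (simp add: free_on_def)
  have "f v *\<^sub>v x \<in> carrier_vec (rdim N v)" using is_homD(1)[OF f v] x by simp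
  then obtain m where m: "m \<in> carrier_vec (rdim M v)" "g v *\<^sub>v m = f v *\<^sub>v x"
    using g v unfolding is_epi_def by blast
  obtain h where h: "is_hom Q P M h" "h v *\<^sub>v x = m" using free M m(1) unfolding free_on_def by blast
  have "(g v * h v) *\<^sub>v x = f v *\<^sub>v x"
    using is_homD(1)[OF gh v] is_homD(1)[OF h(1) v] x h(2) m(2) by simp
  then have "\<forall>w\<in>verts Q. g w * h w = f w"
    using free is_hom_comp[OF Q P M N h(1) gh] N f unfolding free_on_def by blast
  then show "\<exists>h. is_hom Q P M h \<and> (\<forall>v\<in>verts Q. g v * h v = f v)" using h(1) by blast
qed

text \<open>Both composites fix the generator, hence are identities. This makes the vertex alone
  determine the isomorphism class.\<close>

lemma free_on_iso:
  assumes Q: "wf_quiver Q" and v: "v \<in> verts Q" and M: "is_rep_J2 Q M" and N: "is_rep_J2 Q N"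
    and fM: "free_on Q M v x" and fN: "free_on Q N v y"
  shows "rep_iso Q M N"
proof -
  have x: "x \<in> carrier_vec (rdim M v)" and y: "y \<in> carrier_vec (rdim N v)"
    using fM fN by (auto simp: free_on_def)
  obtain f where f: "is_hom Q M N f" "f v *\<^sub>v x = y" using fM N y unfolding free_on_def by blast
  obtain g where g: "is_hom Q N M g" "g v *\<^sub>v y = x" using fN M x unfolding free_on_def by blast
  have "(g v * f v) *\<^sub>v x = 1\<^sub>m (rdim M v) *\<^sub>v x" "(f v * g v) *\<^sub>v y = 1\<^sub>m (rdim N v) *\<^sub>v y"
    using is_homD(1)[OF f(1) v] is_homD(1)[OF g(1) v] x y f(2) g(2) by auto
  then have "\<forall>w\<in>verts Q. g w * f w = 1\<^sub>m (rdim M w)" "\<forall>w\<in>verts Q. f w * g w = 1\<^sub>m (rdim N w)"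
    using fM fN is_hom_comp[OF Q M N M f(1) g(1)] is_hom_comp[OF Q N M N g(1) f(1)]
      is_hom_id[OF M] is_hom_id[OF N] M N unfolding free_on_def by blast+
  then show ?thesis using f(1) g(1) unfolding rep_iso_def by blast
qed

text \<open>Coordinate functionals for a would-be basis consisting of a generator \<open>x\<close> at \<open>v\<close>
  (coordinate \<open>\<psi>\<close>) and the vectors \<open>c x\<close> for the arrows \<open>c\<close> leaving \<open>v\<close> (coordinates \<open>l c\<close>).
  The conditions say that \<open>y \<mapsto> \<psi>(y) e + \<Sum>c. (l c)(y) c\<close> is a homomorphism to the projective at \<open>v\<close>.\<close>
definition gen_data :: "('v, 'a) quiver \<Rightarrow> ('v, 'a, 'k::field) rep \<Rightarrow> 'v \<Rightarrow> 'k vec \<Rightarrow> ('a \<Rightarrow> 'k vec) \<Rightarrow> bool"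
  where "gen_data Q M v \<psi> l \<longleftrightarrow> \<psi> \<in> carrier_vec (rdim M v)
    \<and> (\<forall>c\<in>arrs Q. src Q c = v \<longrightarrow> l c \<in> carrier_vec (rdim M (tgt Q c)))
    \<and> (\<forall>c\<in>arrs Q. tgt Q c = v \<longrightarrow> transpose_mat (rmap M c) *\<^sub>v \<psi> = 0\<^sub>v (rdim M (src Q c)))
    \<and> (\<forall>d\<in>arrs Q. \<forall>c\<in>arrs Q. src Q d = v \<and> tgt Q c = tgt Q d \<longrightarrow>
        transpose_mat (rmap M c) *\<^sub>v l d = (if c = d then \<psi> else 0\<^sub>v (rdim M (src Q c))))"

text \<open>The coordinate map of \<open>gen_data\<close> followed by the map from the projective at
  \<open>v\<close> to \<open>N\<close> that sends the generator to \<open>n\<close>, hence an arrow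
  \<open>c\<close> to \<open>rmap N c *\<^sub>v n\<close>. At \<open>w = v\<close> the sum runs over
  the loops.\<close>

definition gen_hom :: "('v, 'a) quiver \<Rightarrow> ('v, 'a, 'k::field) rep \<Rightarrow> ('v, 'a, 'k) rep
    \<Rightarrow> 'v \<Rightarrow> 'k vec \<Rightarrow> ('a \<Rightarrow> 'k vec) \<Rightarrow> 'k vec \<Rightarrow> 'v \<Rightarrow> 'k mat" where
  "gen_hom Q M N v \<psi> l n w = mat (rdim N w) (rdim M w) (\<lambda>(i, j).
     (if w = v then n $ i * \<psi> $ j else 0)
     + (\<Sum>c | c \<in> arrs Q \<and> src Q c = v \<and> tgt Q c = w. (rmap N c *\<^sub>v n) $ i * l c $ j))"

lemma gen_hom_carrier [simp]: "gen_hom Q M N v \<psi> l n w \<in> carrier_mat (rdim N w) (rdim M w)"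
  by (simp add: gen_hom_def)

lemma gen_hom_apply:
  assumes y: "y \<in> carrier_vec (rdim M w)" and i: "i < rdim N w"
  shows "(gen_hom Q M N v \<psi> l n w *\<^sub>v y) $ i = (if w = v then n $ i * (\<psi> \<bullet> y) else 0)
     + (\<Sum>c | c \<in> arrs Q \<and> src Q c = v \<and> tgt Q c = w. (rmap N c *\<^sub>v n) $ i * (l c \<bullet> y))"
proof -
  let ?C = "{c. c \<in> arrs Q \<and> src Q c = v \<and> tgt Q c = w}" and ?J = "{0..<rdim M w}"
  have "(gen_hom Q M N v \<psi> l n w *\<^sub>v y) $ i
      = (\<Sum>j\<in>?J. ((if w = v then n $ i * \<psi> $ j else 0) + (\<Sum>c\<in>?C. (rmap N c *\<^sub>v n) $ i * l c $ j)) * y $ j)"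
    using y i by (simp add: gen_hom_def scalar_prod_def)
  also have "\<dots> = (\<Sum>j\<in>?J. (if w = v then n $ i * (\<psi> $ j * y $ j) else 0))
      + (\<Sum>j\<in>?J. \<Sum>c\<in>?C. (rmap N c *\<^sub>v n) $ i * (l c $ j * y $ j))"
    by (simp add: distrib_right sum.distrib sum_distrib_right mult.assoc if_distrib[of "\<lambda>t. t * _"] cong: if_cong)
  also have "(\<Sum>j\<in>?J. \<Sum>c\<in>?C. (rmap N c *\<^sub>v n) $ i * (l c $ j * y $ j))
      = (\<Sum>c\<in>?C. (rmap N c *\<^sub>v n) $ i * (l c \<bullet> y))"
    using y by (subst sum.swap) (simp add: scalar_prod_def sum_distrib_left)
  also have "(\<Sum>j\<in>?J. (if w = v then n $ i * (\<psi> $ j * y $ j) else 0)) = (if w = v then n $ i * (\<psi> \<bullet> y) else 0)"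
    using y by (simp add: scalar_prod_def sum_distrib_left)
  finally show ?thesis .
qed

text \<open>Stated for a general matrix \<open>A\<close>, since it serves both for an arrow of
  \<open>N\<close> and for a component of a homomorphism.\<close>

lemma mult_gen_hom_apply:
  assumes N: "is_rep_J2 Q N" and n: "n \<in> carrier_vec (rdim N v)"
    and A: "A \<in> carrier_mat p (rdim N w)"
    and y: "y \<in> carrier_vec (rdim M w)" and i: "i < p"
  shows "(A *\<^sub>v (gen_hom Q M N v \<psi> l n w *\<^sub>v y)) $ i = (if w = v then (A *\<^sub>v n) $ i * (\<psi> \<bullet> y) else 0)
     + (\<Sum>c | c \<in> arrs Q \<and> src Q c = v \<and> tgt Q c = w. (A *\<^sub>v (rmap N c *\<^sub>v n)) $ i * (l c \<bullet> y))"
proof -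
  let ?C = "{c. c \<in> arrs Q \<and> src Q c = v \<and> tgt Q c = w}" and ?K = "{0..<rdim N w}"
  let ?z = "gen_hom Q M N v \<psi> l n w *\<^sub>v y"
  have d: "dim_vec ?z = rdim N w" by (simp add: gen_hom_def)
  have "(A *\<^sub>v ?z) $ i = (\<Sum>k\<in>?K. A $$ (i, k) * ?z $ k)"
    using A i d by (simp add: scalar_prod_def)
  also have "\<dots> = (\<Sum>k\<in>?K. (if w = v then A $$ (i, k) * n $ k * (\<psi> \<bullet> y) else 0)
      + (\<Sum>c\<in>?C. A $$ (i, k) * (rmap N c *\<^sub>v n) $ k * (l c \<bullet> y)))"
    using y by (intro sum.cong)
      (auto simp: gen_hom_apply algebra_simps sum_distrib_left)
  also have "\<dots> = (\<Sum>k\<in>?K. (if w = v then A $$ (i, k) * n $ k * (\<psi> \<bullet> y) else 0))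
      + (\<Sum>c\<in>?C. \<Sum>k\<in>?K. A $$ (i, k) * (rmap N c *\<^sub>v n) $ k * (l c \<bullet> y))"
    by (simp only: sum.distrib sum.swap[of _ ?C ?K])
  also have "(\<Sum>k\<in>?K. (if w = v then A $$ (i, k) * n $ k * (\<psi> \<bullet> y) else 0))
      = (if w = v then (A *\<^sub>v n) $ i * (\<psi> \<bullet> y) else 0)"
    using A n i by (auto simp: scalar_prod_def sum_distrib_right)
  also have "(\<Sum>c\<in>?C. \<Sum>k\<in>?K. A $$ (i, k) * (rmap N c *\<^sub>v n) $ k * (l c \<bullet> y))
      = (\<Sum>c\<in>?C. (A *\<^sub>v (rmap N c *\<^sub>v n)) $ i * (l c \<bullet> y))"
  proof (rule sum.cong)
    fix c assume c: "c \<in> ?C"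
    then have "dim_vec (rmap N c *\<^sub>v n) = rdim N w" using is_rep_J2D[OF N] by auto
    then show "(\<Sum>k\<in>?K. A $$ (i, k) * (rmap N c *\<^sub>v n) $ k * (l c \<bullet> y))
        = (A *\<^sub>v (rmap N c *\<^sub>v n)) $ i * (l c \<bullet> y)"
      unfolding sum_distrib_right[symmetric] using A i
      by (simp add: scalar_prod_def[of _ "rmap N c *\<^sub>v n"])
  qed simp
  finally show ?thesis .
qed

text \<open>Evaluate both sides along an arrow \<open>a\<close>. After \<open>a\<close>, the
  functional \<open>\<psi>\<close> vanishes and among the \<open>l d\<close> only \<open>l a\<close>
  survives, where it becomes \<open>\<psi>\<close>. Before \<open>a\<close>, the terms from arrows
  \<open>c\<close> die because \<open>rmap N a\<close> and \<open>rmap N c\<close> compose to zero.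
  Both sides leave the same single term, present only if \<open>a\<close> starts at
  \<open>v\<close>.\<close>

lemma gen_hom_is_hom:
  assumes Q: "wf_quiver Q" and fin: "finite (arrs Q)" and M: "is_rep_J2 Q M" and N: "is_rep_J2 Q N"
    and n: "n \<in> carrier_vec (rdim N v)" and gd: "gen_data Q M v \<psi> l"
  shows "is_hom Q M N (gen_hom Q M N v \<psi> l n)"
proof -
  let ?h = "gen_hom Q M N v \<psi> l n"
  have "?h (tgt Q a) * rmap M a = rmap N a * ?h (src Q a)" if a: "a \<in> arrs Q" for a
  proof (rule eq_mat_if_eq_on_vec)
    let ?s = "src Q a" and ?t = "tgt Q a"
    note Ma = is_rep_J2D[OF M a] and Na = is_rep_J2D[OF N a]
    show "?h ?t * rmap M a \<in> carrier_mat (rdim N ?t) (rdim M ?s)"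
      using Ma by (intro mult_carrier_mat[of _ _ "rdim M ?t"]) auto
    show "rmap N a * ?h ?s \<in> carrier_mat (rdim N ?t) (rdim M ?s)"
      using Na by (intro mult_carrier_mat[of _ _ "rdim N ?s"]) auto
    fix y :: "'c vec" assume y: "y \<in> carrier_vec (rdim M ?s)"
    have May: "rmap M a *\<^sub>v y \<in> carrier_vec (rdim M ?t)" using Ma y by simp
    have tr: "f \<bullet> (rmap M a *\<^sub>v y) = (transpose_mat (rmap M a) *\<^sub>v f) \<bullet> y"
      if "f \<in> carrier_vec (rdim M ?t)" for f
      using transpose_vec_mult_scalar[OF Ma y that] by simp
    have \<psi>0: "\<psi> \<bullet> (rmap M a *\<^sub>v y) = 0" if "?t = v"
      using tr[of \<psi>] gd a y that by (auto simp: gen_data_def)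
    have ld: "l d \<bullet> (rmap M a *\<^sub>v y) = (if a = d then \<psi> \<bullet> y else 0)"
      if "d \<in> arrs Q" "src Q d = v" "tgt Q d = ?t" for d
      using tr[of "l d"] gd a y that by (auto simp: gen_data_def)
    have "(?h ?t *\<^sub>v (rmap M a *\<^sub>v y)) $ i = (rmap N a *\<^sub>v (?h ?s *\<^sub>v y)) $ i" if i: "i < rdim N ?t" for i
    proof -
      let ?C = "\<lambda>w. {c. c \<in> arrs Q \<and> src Q c = v \<and> tgt Q c = w}"
      have "(?h ?t *\<^sub>v (rmap M a *\<^sub>v y)) $ i
          = (\<Sum>d\<in>?C ?t. (rmap N d *\<^sub>v n) $ i * (l d \<bullet> (rmap M a *\<^sub>v y)))"
        using gen_hom_apply[OF May i, of Q v \<psi> l n] \<psi>0 by auto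
      also have "\<dots> = (\<Sum>d\<in>?C ?t. if a = d then (rmap N d *\<^sub>v n) $ i * (\<psi> \<bullet> y) else 0)"
        using ld by (intro sum.cong) auto
      also have "\<dots> = (if ?s = v then (rmap N a *\<^sub>v n) $ i * (\<psi> \<bullet> y) else 0)"
        using fin a by simp
      \<comment> \<open>The added sum is zero, as two consecutive arrows act as zero on
        \<open>N\<close>.\<close>
      also have "\<dots> = \<dots> + (\<Sum>c\<in>?C ?s. (rmap N a *\<^sub>v (rmap N c *\<^sub>v n)) $ i * (l c \<bullet> y))"
        using rep_apply_twice[OF N _ a] n i by simp
      also have "\<dots> = (rmap N a *\<^sub>v (?h ?s *\<^sub>v y)) $ i"
        by (rule mult_gen_hom_apply[OF N n Na y i, symmetric])
      finally show ?thesis .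
    qed
    then have "?h ?t *\<^sub>v (rmap M a *\<^sub>v y) = rmap N a *\<^sub>v (?h ?s *\<^sub>v y)"
      using Na by (intro eq_vecI) (auto simp: gen_hom_def)
    then show "(?h ?t * rmap M a) *\<^sub>v y = (rmap N a * ?h ?s) *\<^sub>v y"
      using assoc_mult_mat_vec[OF gen_hom_carrier Ma y, of Q N v \<psi> l n]
        assoc_mult_mat_vec[OF Na gen_hom_carrier y, of Q v \<psi> l n] by simp
  qed
  then show ?thesis by (simp add: is_hom_def)
qed

text \<open>Naturality in the chosen vector, used twice: with \<open>f\<close> the endomorphism
  itself it yields idempotency, and once that endomorphism is the identity it shows that
  \<open>f\<close> is determined by its value at \<open>x\<close>.\<close>

lemma hom_mult_gen_hom:
  assumes M: "is_rep_J2 Q M" and N: "is_rep_J2 Q N" and f: "is_hom Q M N f"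
    and v: "v \<in> verts Q" and w: "w \<in> verts Q" and x: "x \<in> carrier_vec (rdim M v)"
  shows "f w * gen_hom Q M M v \<psi> l x w = gen_hom Q M N v \<psi> l (f v *\<^sub>v x) w"
proof (rule eq_mat_if_eq_on_vec)
  note fw = is_homD(1)[OF f w]
  show "f w * gen_hom Q M M v \<psi> l x w \<in> carrier_mat (rdim N w) (rdim M w)"
    using fw by (intro mult_carrier_mat[of _ _ "rdim M w"]) auto
  show "gen_hom Q M N v \<psi> l (f v *\<^sub>v x) w \<in> carrier_mat (rdim N w) (rdim M w)" by simp
  fix y :: "'c vec" assume y: "y \<in> carrier_vec (rdim M w)"
  have fc: "f w *\<^sub>v (rmap M c *\<^sub>v x) = rmap N c *\<^sub>v (f v *\<^sub>v x)"
    if c: "c \<in> arrs Q" "src Q c = v" "tgt Q c = w" for c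
    using is_homD(2)[OF f c(1)] is_rep_J2D[OF M c(1)] is_rep_J2D[OF N c(1)] fw is_homD(1)[OF f v] x c(2,3)
    by (metis assoc_mult_mat_vec)
  have "f w *\<^sub>v (gen_hom Q M M v \<psi> l x w *\<^sub>v y) = gen_hom Q M N v \<psi> l (f v *\<^sub>v x) w *\<^sub>v y"
  proof (rule eq_vecI)
    fix i assume "i < dim_vec (gen_hom Q M N v \<psi> l (f v *\<^sub>v x) w *\<^sub>v y)"
    then have i: "i < rdim N w" by (simp add: gen_hom_def)
    show "(f w *\<^sub>v (gen_hom Q M M v \<psi> l x w *\<^sub>v y)) $ i = (gen_hom Q M N v \<psi> l (f v *\<^sub>v x) w *\<^sub>v y) $ i"
      unfolding mult_gen_hom_apply[OF M x fw y i] gen_hom_apply[OF y i]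
      by (intro arg_cong2[where f = "(+)"] sum.cong) (auto simp: fc)
  qed (use fw in \<open>simp add: gen_hom_def\<close>)
  then show "(f w * gen_hom Q M M v \<psi> l x w) *\<^sub>v y = gen_hom Q M N v \<psi> l (f v *\<^sub>v x) w *\<^sub>v y"
    using assoc_mult_mat_vec[OF fw gen_hom_carrier y] by simp
qed

lemma gen_hom_at_gen:
  assumes M: "is_rep_J2 Q M" and N: "is_rep_J2 Q N" and x: "x \<in> carrier_vec (rdim M v)"
    and n: "n \<in> carrier_vec (rdim N v)" and 1: "\<psi> \<bullet> x = 1"
    and 0: "\<And>c. c \<in> arrs Q \<Longrightarrow> src Q c = v \<Longrightarrow> tgt Q c = v \<Longrightarrow> l c \<bullet> x = 0"
  shows "gen_hom Q M N v \<psi> l n v *\<^sub>v x = n"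
  using n by (intro eq_vecI) (auto simp: gen_hom_apply[OF x] 0 1, simp add: gen_hom_def)

text \<open>If \<open>v\<close> carries a loop, \<open>\<psi> \<bullet> x = 1\<close> does not yet
  make the endomorphism fix \<open>x\<close>. Subtracting a multiple of \<open>\<psi>\<close> from
  the functional of the loop repairs this; the conditions survive because \<open>\<psi>\<close>
  vanishes on the image of every arrow into \<open>v\<close>.\<close>

lemma gen_data_kill_loops:
  assumes M: "is_rep_J2 Q M" and x: "x \<in> carrier_vec (rdim M v)"
    and gd: "gen_data Q M v \<psi> l" and 1: "\<psi> \<bullet> x = 1"
  shows "\<exists>l'. gen_data Q M v \<psi> l' \<and> (\<forall>c\<in>arrs Q. src Q c = v \<and> tgt Q c = v \<longrightarrow> l' c \<bullet> x = 0)"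
proof -
  define l' where "l' c = (if tgt Q c = v then l c - (l c \<bullet> x) \<cdot>\<^sub>v \<psi> else l c)" for c
  have \<psi>: "\<psi> \<in> carrier_vec (rdim M v)" using gd by (simp add: gen_data_def)
  have lc: "l c \<in> carrier_vec (rdim M (tgt Q c))" if "c \<in> arrs Q" "src Q c = v" for c
    using gd that by (simp add: gen_data_def)
  have "l' c \<bullet> x = 0" if "c \<in> arrs Q" "src Q c = v" "tgt Q c = v" for c
    using lc[OF that(1,2)] that \<psi> x 1 by (simp add: l'_def minus_scalar_prod_distrib[of _ "rdim M v"])
  moreover have "transpose_mat (rmap M c) *\<^sub>v l' d = transpose_mat (rmap M c) *\<^sub>v l d"
    if c: "c \<in> arrs Q" "d \<in> arrs Q" "src Q d = v" "tgt Q c = tgt Q d" for c d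
  proof (cases "tgt Q d = v")
    case True
    have T: "transpose_mat (rmap M c) \<in> carrier_mat (rdim M (src Q c)) (rdim M v)"
      using is_rep_J2D[OF M c(1)] c True by simp
    have "transpose_mat (rmap M c) *\<^sub>v \<psi> = 0\<^sub>v (rdim M (src Q c))"
      using gd c True by (simp add: gen_data_def)
    then show ?thesis
      using T lc[OF c(2,3)] \<psi> True mult_minus_distrib_mat_vec[OF T, of "l d" "(l d \<bullet> x) \<cdot>\<^sub>v \<psi>"]
        mult_mat_vec[OF T \<psi>, of "l d \<bullet> x"]
      by (simp add: l'_def) (intro eq_vecI, auto)
  qed (simp add: l'_def)
  moreover have "l' c \<in> carrier_vec (rdim M (tgt Q c))" if "c \<in> arrs Q" "src Q c = v" for c
    using lc[OF that] \<psi> by (auto simp: l'_def intro!: minus_carrier_vec)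
  ultimately show ?thesis
    using gd by (intro exI[of _ l']) (simp add: gen_data_def)
qed

text \<open>The endomorphism attached to \<open>x\<close> fixes \<open>x\<close>, so by naturality
  it is idempotent. It is nonzero, since \<open>x\<close> is, and indecomposability makes it the
  identity. Homomorphisms with a prescribed value at \<open>x\<close> then exist by the formula and
  are unique by naturality.\<close>

lemma free_on_if_gen_data:
  fixes M :: "('v, 'a, 'k::field) rep"
  assumes Q: "wf_quiver Q" and fin: "finite (arrs Q)" and M: "is_rep_J2 Q M" and ind: "indecomposable Q M"
    and v: "v \<in> verts Q" and x: "x \<in> carrier_vec (rdim M v)" and gd: "gen_data Q M v \<psi> l" and 1: "\<psi> \<bullet> x = 1"
  shows "free_on Q M v x"
proof -
  from gen_data_kill_loops[OF M x gd 1] obtain l where gd: "gen_data Q M v \<psi> l"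
    and 0: "\<And>c. c \<in> arrs Q \<Longrightarrow> src Q c = v \<Longrightarrow> tgt Q c = v \<Longrightarrow> l c \<bullet> x = 0" by blast
  let ?e = "gen_hom Q M M v \<psi> l x"
  have e: "is_hom Q M M ?e" by (rule gen_hom_is_hom[OF Q fin M M x gd])
  have ex: "?e v *\<^sub>v x = x" by (rule gen_hom_at_gen[OF M M x x 1 0])
  have nz: "?e v \<noteq> 0\<^sub>m (rdim M v) (rdim M v)"
  proof
    assume "?e v = 0\<^sub>m (rdim M v) (rdim M v)"
    then have "x = 0\<^sub>v (rdim M v)" using ex x by simp
    moreover have "\<psi> \<in> carrier_vec (rdim M v)" using gd by (simp add: gen_data_def)
    ultimately show False using 1 by simp
  qed
  have "?e w * ?e w = ?e w" if w: "w \<in> verts Q" for w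
    using hom_mult_gen_hom[OF M M e v w x, of \<psi> l] ex by simp
  then have e1: "\<forall>w\<in>verts Q. ?e w = 1\<^sub>m (rdim M w)"
    using indecomposable_idempotent[OF Q M ind e] nz v by blast
  \<comment> \<open>Here \<open>h\<close> equals \<open>h\<close> composed with the identity
    \<open>?e\<close>; the right-hand side depends on \<open>h\<close> only through its value at
    \<open>x\<close>.\<close>
  have h: "h w = gen_hom Q M N v \<psi> l (h v *\<^sub>v x) w"
    if "is_rep_J2 Q N" "is_hom Q M N h" "w \<in> verts Q" for N h w
    using hom_mult_gen_hom[OF M that(1,2) v that(3) x, of \<psi> l] e1 that(3)
      right_mult_one_mat[OF is_homD(1)[OF that(2,3)]] by simp
  show ?thesis
    unfolding free_on_def
  proof (intro conjI allI ballI impI)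
    fix N :: "('v, 'a, 'k) rep" and n :: "'k vec" assume n: "n \<in> carrier_vec (rdim N v)" and N: "is_rep_J2 Q N"
    show "\<exists>h. is_hom Q M N h \<and> h v *\<^sub>v x = n"
      using gen_hom_is_hom[OF Q fin M N n gd] gen_hom_at_gen[where l = l, OF M N x n 1 0] by blast
  next
    fix N h h' w
    assume A: "is_rep_J2 Q N \<and> is_hom Q M N h \<and> is_hom Q M N h' \<and> h v *\<^sub>v x = h' v *\<^sub>v x"
      and w: "w \<in> verts Q"
    then show "h w = h' w" using h[of N h w] h[of N h' w] by simp
  qed (rule x)
qed

section \<open>Duality\<close>

definition op_quiver :: "('v, 'a) quiver \<Rightarrow> ('v, 'a) quiver" where
  "op_quiver Q = \<lparr>verts = verts Q, arrs = arrs Q, src = tgt Q, tgt = src Q\<rparr>"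

definition op_rep :: "('v, 'a, 'k::field) rep \<Rightarrow> ('v, 'a, 'k) rep" where
  "op_rep M = \<lparr>rdim = rdim M, rmap = \<lambda>a. transpose_mat (rmap M a)\<rparr>"

lemma op_quiver_sel [simp]:
  "verts (op_quiver Q) = verts Q" "arrs (op_quiver Q) = arrs Q"
  "src (op_quiver Q) = tgt Q" "tgt (op_quiver Q) = src Q"
  by (simp_all add: op_quiver_def)

lemma op_rep_sel [simp]:
  "rdim (op_rep M) = rdim M" "rmap (op_rep M) a = transpose_mat (rmap M a)"
  by (simp_all add: op_rep_def)

lemma op_op_quiver [simp]: "op_quiver (op_quiver Q) = (Q :: ('v, 'a) quiver)"
  by (simp add: op_quiver_def)

lemma op_op_rep [simp]: "op_rep (op_rep M) = (M :: ('v, 'a, 'k::field) rep)"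
  by (simp add: op_rep_def)

lemma wf_op_quiver [simp]: "wf_quiver (op_quiver Q) = wf_quiver Q"
  by (auto simp: wf_quiver_def)

lemma indeg_op_quiver [simp]: "indeg (op_quiver Q) = outdeg Q"
  by (simp add: indeg_def outdeg_def fun_eq_iff)

lemma outdeg_op_quiver [simp]: "outdeg (op_quiver Q) = indeg Q"
  by (simp add: indeg_def outdeg_def fun_eq_iff)

lemma rep_nonzero_op [simp]: "rep_nonzero (op_quiver Q) (op_rep M) = rep_nonzero Q M"
  by (simp add: rep_nonzero_def)

lemma is_rep_op:
  assumes M: "is_rep_J2 Q M"
  shows "is_rep_J2 (op_quiver Q) (op_rep M)"
proof -
  have "transpose_mat (rmap M b) * transpose_mat (rmap M a) = 0\<^sub>m (rdim M (src Q b)) (rdim M (tgt Q a))"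
    if a: "a \<in> arrs Q" and b: "b \<in> arrs Q" and ab: "tgt Q b = src Q a" for a b
  proof -
    have "transpose_mat (rmap M b) * transpose_mat (rmap M a) = transpose_mat (rmap M a * rmap M b)"
      using transpose_mult[OF is_rep_J2D[OF M a] is_rep_J2D[OF M b, unfolded ab]] by simp
    also have "rmap M a * rmap M b = 0\<^sub>m (rdim M (tgt Q a)) (rdim M (src Q b))"
      using M a b ab by (simp add: is_rep_J2_def)
    finally show ?thesis by simp
  qed
  then show ?thesis using is_rep_J2D[OF M] by (simp add: is_rep_J2_def)
qed

lemma is_hom_op:
  assumes Q: "wf_quiver Q" and M: "is_rep_J2 Q M" and N: "is_rep_J2 Q N" and f: "is_hom Q M N f"
  shows "is_hom (op_quiver Q) (op_rep N) (op_rep M) (\<lambda>v. transpose_mat (f v))"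
proof -
  have "transpose_mat (f (src Q a)) * transpose_mat (rmap N a)
      = transpose_mat (rmap M a) * transpose_mat (f (tgt Q a))" if a: "a \<in> arrs Q" for a
    using transpose_mult[OF is_rep_J2D[OF N a] is_homD(1)[OF f wf_quiverD(1)[OF Q a]]]
      transpose_mult[OF is_homD(1)[OF f wf_quiverD(2)[OF Q a]] is_rep_J2D[OF M a]]
      is_homD(2)[OF f a] by simp
  then show ?thesis using is_homD(1)[OF f] by (simp add: is_hom_def)
qed

lemma rep_iso_op:
  assumes Q: "wf_quiver Q" and M: "is_rep_J2 Q M" and N: "is_rep_J2 Q N" and iso: "rep_iso Q M N"
  shows "rep_iso (op_quiver Q) (op_rep M) (op_rep N)"
proof -
  obtain f g where f: "is_hom Q M N f" and g: "is_hom Q N M g"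
    and gf: "\<And>v. v \<in> verts Q \<Longrightarrow> g v * f v = 1\<^sub>m (rdim M v)"
    and fg: "\<And>v. v \<in> verts Q \<Longrightarrow> f v * g v = 1\<^sub>m (rdim N v)"
    using iso unfolding rep_iso_def by blast
  have "transpose_mat (f v) * transpose_mat (g v) = 1\<^sub>m (rdim M v)"
    "transpose_mat (g v) * transpose_mat (f v) = 1\<^sub>m (rdim N v)" if v: "v \<in> verts Q" for v
    using transpose_mult[OF is_homD(1)[OF g v] is_homD(1)[OF f v]]
      transpose_mult[OF is_homD(1)[OF f v] is_homD(1)[OF g v]] gf[OF v] fg[OF v] by simp_all
  then show ?thesis
    using is_hom_op[OF Q M N f] is_hom_op[OF Q N M g] unfolding rep_iso_def
    by (intro exI[of _ "\<lambda>v. transpose_mat (g v)"] exI[of _ "\<lambda>v. transpose_mat (f v)"]) simp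
qed

text \<open>Outside \<open>arrs Q\<close> the matrices of a representation have unconstrained
  shapes, so below the transpose of a direct sum is compared with the direct sum of transposes only
  on arrows.\<close>

lemma rep_iso_cong:
  assumes "rdim N = rdim N'" and "\<And>a. a \<in> arrs Q \<Longrightarrow> rmap N a = rmap N' a"
  shows "rep_iso Q M N = rep_iso Q M N'"
  using assms by (simp add: rep_iso_def is_hom_def)

lemma is_rep_dsum:
  assumes M: "is_rep_J2 Q M" and N: "is_rep_J2 Q N"
  shows "is_rep_J2 Q (rep_dsum Q M N)"
proof -
  have "rmap (rep_dsum Q M N) b * rmap (rep_dsum Q M N) a
      = 0\<^sub>m (rdim (rep_dsum Q M N) (tgt Q b)) (rdim (rep_dsum Q M N) (src Q a))"
    if a: "a \<in> arrs Q" and b: "b \<in> arrs Q" and ba: "src Q b = tgt Q a" for a b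
  proof -
    note c = is_rep_J2D[OF M a] is_rep_J2D[OF N a] is_rep_J2D[OF M b] is_rep_J2D[OF N b]
    have z: "rmap M b * rmap M a = 0\<^sub>m (rdim M (tgt Q b)) (rdim M (src Q a))"
      "rmap N b * rmap N a = 0\<^sub>m (rdim N (tgt Q b)) (rdim N (src Q a))"
      using M N a b ba by (simp_all add: is_rep_J2_def)
    show ?thesis
      unfolding rep_dsum_def rep.simps ba
      by (subst mult_four_block_mat[of _ "rdim M (tgt Q b)" "rdim M (tgt Q a)" _ "rdim N (tgt Q a)" _
            "rdim N (tgt Q b)" _ _ "rdim M (src Q a)" _ "rdim N (src Q a)"])
        (use c ba z in auto)
  qed
  then show ?thesis using is_rep_J2D[OF M] is_rep_J2D[OF N] by (simp add: is_rep_J2_def rep_dsum_def)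
qed

text \<open>A decomposition of the dual transposes back to a decomposition of \<open>M\<close>,
  because double transposition is the identity.\<close>

lemma indecomposable_op:
  fixes M :: "('v, 'a, 'k::field) rep"
  assumes Q: "wf_quiver Q" and M: "is_rep_J2 Q M" and ind: "indecomposable Q M"
  shows "indecomposable (op_quiver Q) (op_rep M)"
  unfolding indecomposable_def
proof (intro conjI notI)
  show "rep_nonzero (op_quiver Q) (op_rep M)" using ind by (simp add: indecomposable_def)
  assume "\<exists>N1 N2. is_rep_J2 (op_quiver Q) N1 \<and> is_rep_J2 (op_quiver Q) N2
    \<and> rep_nonzero (op_quiver Q) N1 \<and> rep_nonzero (op_quiver Q) N2
    \<and> rep_iso (op_quiver Q) (op_rep M) (rep_dsum (op_quiver Q) N1 N2)"
  then obtain N1 N2 :: "('v, 'a, 'k) rep" where N1: "is_rep_J2 (op_quiver Q) N1" "rep_nonzero (op_quiver Q) N1"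
    and N2: "is_rep_J2 (op_quiver Q) N2" "rep_nonzero (op_quiver Q) N2"
    and iso: "rep_iso (op_quiver Q) (op_rep M) (rep_dsum (op_quiver Q) N1 N2)" by blast
  have "rep_iso Q M (op_rep (rep_dsum (op_quiver Q) N1 N2))"
    using rep_iso_op[OF _ is_rep_op[OF M] is_rep_dsum[OF N1(1) N2(1)] iso] Q by simp
  also have "rep_iso Q M (op_rep (rep_dsum (op_quiver Q) N1 N2))
      = rep_iso Q M (rep_dsum Q (op_rep N1) (op_rep N2))"
  proof (rule rep_iso_cong)
    fix a assume "a \<in> arrs Q"
    then show "rmap (op_rep (rep_dsum (op_quiver Q) N1 N2)) a = rmap (rep_dsum Q (op_rep N1) (op_rep N2)) a"
      using is_rep_J2D[OF N1(1)] is_rep_J2D[OF N2(1)]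
      by (simp add: rep_dsum_def
          transpose_four_block_mat[where ?nr1.0 = "rdim N1 (src Q a)" and ?nc1.0 = "rdim N1 (tgt Q a)"
            and ?nr2.0 = "rdim N2 (src Q a)" and ?nc2.0 = "rdim N2 (tgt Q a)"])
  qed (simp add: rep_dsum_def)
  finally show False
    using ind is_rep_op[OF N1(1)] is_rep_op[OF N2(1)] N1(2) N2(2)
      rep_nonzero_op[of "op_quiver Q" N1] rep_nonzero_op[of "op_quiver Q" N2]
    unfolding indecomposable_def op_op_quiver by blast
qed

text \<open>Transposition turns the extension problem along a monomorphism into a lifting problem
  along an epimorphism.\<close>

lemma injective_if_op_projective:
  fixes I :: "('v, 'a, 'k::field) rep"
  assumes Q: "wf_quiver Q" and I: "is_rep_J2 Q I" and proj: "projective_rep (op_quiver Q) (op_rep I)"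
  shows "injective_rep Q I"
  unfolding injective_rep_def
proof (intro allI impI, elim conjE)
  fix M N g f
  assume M: "is_rep_J2 Q M" and N: "is_rep_J2 Q N" and g: "is_mono Q M N g" and f: "is_hom Q M I f"
  have gh: "is_hom Q M N g" using g by (simp add: is_mono_def)
  have "is_epi (op_quiver Q) (op_rep N) (op_rep M) (\<lambda>v. transpose_mat (g v))"
    unfolding is_epi_def
  proof (intro conjI ballI)
    show "is_hom (op_quiver Q) (op_rep N) (op_rep M) (\<lambda>v. transpose_mat (g v))"
      by (rule is_hom_op[OF Q M N gh])
    fix v and y :: "'k vec" assume "v \<in> verts (op_quiver Q)" "y \<in> carrier_vec (rdim (op_rep M) v)"
    then have v: "v \<in> verts Q" and y: "y \<in> carrier_vec (rdim M v)" by simp_all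
    show "\<exists>x\<in>carrier_vec (rdim (op_rep N) v). transpose_mat (g v) *\<^sub>v x = y"
      using transpose_surj_if_inj[OF is_homD(1)[OF gh v] _ y] g v by (auto simp: is_mono_def)
  qed
  then obtain h where h: "is_hom (op_quiver Q) (op_rep I) (op_rep N) h"
    and gh': "\<And>v. v \<in> verts Q \<Longrightarrow> transpose_mat (g v) * h v = transpose_mat (f v)"
    using proj is_rep_op[OF M] is_rep_op[OF N] is_hom_op[OF Q M I f]
    unfolding projective_rep_def op_quiver_sel by blast
  have "is_hom Q N I (\<lambda>v. transpose_mat (h v))"
    using is_hom_op[OF _ is_rep_op[OF I] is_rep_op[OF N] h] Q by simp
  moreover have "transpose_mat (h v) * g v = f v" if v: "v \<in> verts Q" for v
    using transpose_mult[of "transpose_mat (g v)" "rdim M v" "rdim N v" "h v" "rdim I v"]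
      is_homD(1)[OF gh v] is_homD(1)[OF h, of v] v gh'[OF v] by simp
  ultimately show "\<exists>h. is_hom Q N I h \<and> (\<forall>v\<in>verts Q. h v * g v = f v)" by blast
qed

section \<open>Classification of the indecomposables\<close>

text \<open>The bound on the out-degree is the half of the dichotomy arranged by duality. It leaves
  one functional \<open>\<phi>\<close> at the target of \<open>a\<close> to be found, subject only
  to conditions from the other arrow into that vertex.\<close>

lemma indecomposable_generated_or_cogenerated:
  fixes M :: "('v, 'a, 'k::field) rep"
  assumes Q: "wf_quiver Q" and fin: "finite (arrs Q)" and M: "is_rep_J2 Q M" and ind: "indecomposable Q M"
    and a: "a \<in> arrs Q" and nz: "rmap M a \<noteq> 0\<^sub>m (rdim M (tgt Q a)) (rdim M (src Q a))"
    and out: "outdeg Q (src Q a) \<le> 1" and inc: "indeg Q (tgt Q a) \<le> 2"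
    and deg: "\<And>b. b \<in> arrs Q \<Longrightarrow> outdeg Q (src Q b) + indeg Q (tgt Q b) \<le> 3"
  shows "(\<exists>v\<in>verts Q. \<exists>x. free_on Q M v x) \<or> (\<exists>v\<in>verts Q. \<exists>x. free_on (op_quiver Q) (op_rep M) v x)"
proof -
  let ?v = "src Q a" and ?u = "tgt Q a"
  note w = wf_quiverD[OF Q a] and Ma = is_rep_J2D[OF M a]
  have only: "c = d" if "c \<in> arrs Q" "d \<in> arrs Q" "src Q c = src Q d" "outdeg Q (src Q d) \<le> 1" for c d
    using that fin card_le_Suc0_iff_eq[of "{b \<in> arrs Q. src Q b = src Q d}"] by (auto simp: outdeg_def)
  obtain x0 where x0: "x0 \<in> carrier_vec (rdim M ?v)" "rmap M a *\<^sub>v x0 \<noteq> 0\<^sub>v (rdim M ?u)"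
    using nz eq_mat_if_eq_on_vec[OF Ma, of "0\<^sub>m (rdim M ?u) (rdim M ?v)"] by auto
  have gen: "free_on Q M ?v x"
    if x: "x \<in> carrier_vec (rdim M ?v)" and \<phi>: "\<phi> \<in> carrier_vec (rdim M ?u)" "\<phi> \<bullet> (rmap M a *\<^sub>v x) = 1"
      and ker: "\<And>c. c \<in> arrs Q \<Longrightarrow> tgt Q c = ?u \<Longrightarrow> c \<noteq> a
        \<Longrightarrow> transpose_mat (rmap M c) *\<^sub>v \<phi> = 0\<^sub>v (rdim M (src Q c))" for x \<phi>
  proof (rule free_on_if_gen_data[OF Q fin M ind w(1) x])
    \<comment> \<open>The condition at the arrow \<open>a\<close> itself forces this choice of
      \<open>\<psi>\<close>. It vanishes on the images of arrows into \<open>v\<close> because the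
      dual representation also satisfies J^2 = 0.\<close>
    let ?\<psi> = "transpose_mat (rmap M a) *\<^sub>v \<phi>"
    have "transpose_mat (rmap M c) *\<^sub>v ?\<psi> = 0\<^sub>v (rdim M (src Q c))" if c: "c \<in> arrs Q" "tgt Q c = ?v" for c
      using rep_apply_twice[OF is_rep_op[OF M], of a c \<phi>] a c \<phi>(1) by simp
    then show "gen_data Q M ?v ?\<psi> (\<lambda>_. \<phi>)"
      using Ma \<phi>(1) ker only[OF _ a _ out] by (auto simp: gen_data_def)
    show "?\<psi> \<bullet> x = 1" using transpose_vec_mult_scalar[OF Ma x \<phi>(1)] \<phi>(2) by simp
  qed
  show ?thesis
  proof (cases "\<exists>b\<in>arrs Q. tgt Q b = ?u \<and> b \<noteq> a")
    case False
    \<comment> \<open>With a matrix without columns, lying outside the image just means being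
      nonzero; the same device returns below.\<close>
    have "0\<^sub>m (rdim M ?u) 0 *\<^sub>v x \<noteq> rmap M a *\<^sub>v x0" if "x \<in> carrier_vec 0" for x
      using x0(2) that by simp
    then obtain \<phi> where "\<phi> \<in> carrier_vec (rdim M ?u)" "\<phi> \<bullet> (rmap M a *\<^sub>v x0) = 1"
      using separating_functional[of "0\<^sub>m (rdim M ?u) 0" "rdim M ?u" 0 "rmap M a *\<^sub>v x0"] Ma x0(1) by auto
    then show ?thesis using gen[OF x0(1)] False w(1) by blast
  next
    case True
    then obtain b where b: "b \<in> arrs Q" "tgt Q b = ?u" "b \<noteq> a" by blast
    note Mb = is_rep_J2D[OF M b(1), unfolded b(2)]
    have sub: "{a, b} \<subseteq> {c \<in> arrs Q. tgt Q c = ?u}" using a b by auto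
    have into: "{c \<in> arrs Q. tgt Q c = ?u} = {a, b}"
      using card_seteq[OF _ sub] fin inc b(3) by (simp add: indeg_def)
    show ?thesis
    proof (cases "\<exists>x\<in>carrier_vec (rdim M ?v). \<forall>z\<in>carrier_vec (rdim M (src Q b)). rmap M b *\<^sub>v z \<noteq> rmap M a *\<^sub>v x")
      case True
      then obtain x where x: "x \<in> carrier_vec (rdim M ?v)"
        and "\<And>z. z \<in> carrier_vec (rdim M (src Q b)) \<Longrightarrow> rmap M b *\<^sub>v z \<noteq> rmap M a *\<^sub>v x" by blast
      then obtain \<phi> where "\<phi> \<in> carrier_vec (rdim M ?u)" "\<phi> \<bullet> (rmap M a *\<^sub>v x) = 1"
        "transpose_mat (rmap M b) *\<^sub>v \<phi> = 0\<^sub>v (rdim M (src Q b))"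
        using separating_functional[OF Mb, of "rmap M a *\<^sub>v x"] Ma by auto
      moreover have "c = b" if "c \<in> arrs Q" "tgt Q c = ?u" "c \<noteq> a" for c using that into by auto
      ultimately show ?thesis using gen[OF x] w(1) by blast
    next
      case False
      then obtain z0 where z0: "z0 \<in> carrier_vec (rdim M (src Q b))" "rmap M b *\<^sub>v z0 = rmap M a *\<^sub>v x0"
        using x0(1) by blast
      \<comment> \<open>Data for the dual at \<open>u\<close>: \<open>?y\<close> plays the role of
        \<open>\<psi>\<close>, and the chosen preimages of \<open>?y\<close> under \<open>a\<close>
        and \<open>b\<close> are the functionals attached to these arrows, which leave
        \<open>u\<close> in the opposite quiver. The generator is any \<open>\<phi>\<close> with
        value 1 at \<open>?y\<close>.\<close>
      let ?y = "rmap M a *\<^sub>v x0" and ?l = "\<lambda>c. if c = a then x0 else z0"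
      have y: "?y \<in> carrier_vec (rdim M ?u)" using Ma x0(1) by simp
      have "0\<^sub>m (rdim M ?u) 0 *\<^sub>v x \<noteq> ?y" if "x \<in> carrier_vec 0" for x using x0(2) that by simp
      then obtain \<phi> where \<phi>: "\<phi> \<in> carrier_vec (rdim M ?u)" "\<phi> \<bullet> ?y = 1"
        using separating_functional[of "0\<^sub>m (rdim M ?u) 0" "rdim M ?u" 0 ?y] y by auto
      have "indeg Q ?u = 2" using into b(3) by (simp add: indeg_def)
      then have outb: "outdeg Q (src Q b) \<le> 1" using deg[OF b(1)] b(2) by simp
      have ab: "c = a \<or> c = b" if "c \<in> arrs Q" "tgt Q c = ?u" for c using that into by auto
      have "gen_data (op_quiver Q) (op_rep M) ?u ?y ?l"
        unfolding gen_data_def op_quiver_sel op_rep_sel transpose_transpose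
      proof (intro conjI ballI impI)
        show "?y \<in> carrier_vec (rdim M ?u)" by (rule y)
      next
        fix c assume "c \<in> arrs Q" "tgt Q c = ?u"
        then show "?l c \<in> carrier_vec (rdim M (src Q c))" using ab x0(1) z0(1) by auto
      next
        fix c assume "c \<in> arrs Q" "src Q c = ?u"
        then show "rmap M c *\<^sub>v ?y = 0\<^sub>v (rdim M (tgt Q c))" using rep_apply_twice[OF M a _ _ x0(1)] by simp
      next
        fix d c assume d: "d \<in> arrs Q" and c: "c \<in> arrs Q" and A: "tgt Q d = ?u \<and> src Q c = src Q d"
        then have "d = a \<or> d = b" using ab by simp
        \<comment> \<open>No arrow other than \<open>d\<close> shares its source, so the vanishing
          conditions are void and only \<open>rmap M d *\<^sub>v ?l d = ?y\<close> remains.\<close>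
        then have "c = d" using only[OF c d] A out outb by blast
        then show "rmap M c *\<^sub>v ?l d = (if c = d then ?y else 0\<^sub>v (rdim M (tgt Q c)))"
          using \<open>d = a \<or> d = b\<close> z0(2) by auto
      qed
      then have "free_on (op_quiver Q) (op_rep M) ?u \<phi>"
        by (rule free_on_if_gen_data[rotated -2])
          (use Q fin is_rep_op[OF M] indecomposable_op[OF Q M ind] w(2) \<phi> comm_scalar_prod[OF \<phi>(1) y] in auto)
      then show ?thesis using w(2) by blast
    qed
  qed
qed

text \<open>When all arrows act as zero, every family of square matrices of the right sizes is an
  endomorphism. The projection to one basis vector at one vertex must then be the identity, which
  leaves no room for a second basis vector.\<close>

lemma concentrated_if_no_arrow_acts:
  assumes Q: "wf_quiver Q" and M: "is_rep_J2 Q M" and ind: "indecomposable Q M"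
    and z: "\<And>a. a \<in> arrs Q \<Longrightarrow> rmap M a = 0\<^sub>m (rdim M (tgt Q a)) (rdim M (src Q a))"
  shows "\<exists>v\<in>verts Q. rdim M v = 1 \<and> (\<forall>w\<in>verts Q. w \<noteq> v \<longrightarrow> rdim M w = 0)"
proof -
  obtain v where v: "v \<in> verts Q" "rdim M v > 0"
    using ind by (auto simp: indecomposable_def rep_nonzero_def)
  define e where "e w = mat (rdim M w) (rdim M w) (\<lambda>(i, j). if w = v \<and> i = 0 \<and> j = 0 then 1 else 0 :: 'c)" for w
  have ec: "e w \<in> carrier_mat (rdim M w) (rdim M w)" for w by (simp add: e_def)
  have "is_hom Q M M e"
    using ec left_mult_zero_mat[OF ec] right_mult_zero_mat[OF ec] by (simp add: is_hom_def z)
  moreover have "e w * e w = e w" for w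
    by (intro eq_matI) (auto simp: e_def scalar_prod_def sum.delta if_distrib[of "\<lambda>t. t * _"] cong: if_cong)
  moreover have "e v \<noteq> 0\<^sub>m (rdim M v) (rdim M v)"
  proof
    assume "e v = 0\<^sub>m (rdim M v) (rdim M v)"
    then have "e v $$ (0, 0) = 0" using v by simp
    then show False using v by (simp add: e_def)
  qed
  ultimately have 1: "\<forall>w\<in>verts Q. e w = 1\<^sub>m (rdim M w)"
    using indecomposable_idempotent[OF Q M ind] v(1) by blast
  have diag: "w = v \<and> i = 0" if "w \<in> verts Q" "i < rdim M w" for w i
  proof -
    have "e w $$ (i, i) = 1" using 1 that by simp
    then show ?thesis using that by (simp add: e_def split: if_splits)
  qed
  have "rdim M v = 1" using diag[OF v(1), of 1] v(2) by (cases "rdim M v" rule: linorder_cases[of _ 1]) auto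
  then show ?thesis using v(1) diag by blast
qed

lemma simple_if_concentrated:
  fixes M :: "('v, 'a, 'k::field) rep"
  assumes v: "v \<in> verts Q" "rdim M v = 1" and 0: "\<forall>w\<in>verts Q. w \<noteq> v \<longrightarrow> rdim M w = 0"
  shows "simple_rep Q M"
  unfolding simple_rep_def
proof (intro conjI allI impI)
  show "rep_nonzero Q M" unfolding rep_nonzero_def by (rule bexI[OF _ v(1)]) (simp add: v(2))
  fix U assume U: "is_subrep Q M U"
  have sub: "is_subspace (rdim M w) (U w)" if "w \<in> verts Q" for w using U that by (simp add: is_subrep_def)
  have triv: "carrier_vec (rdim M w) = {0\<^sub>v (rdim M w) :: 'k vec}" if "w \<in> verts Q" "w \<noteq> v" for w
    using 0 that by auto
  have other: "U w = {0\<^sub>v (rdim M w)}" if "w \<in> verts Q" "w \<noteq> v" for w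
    using sub[OF that(1)] triv[OF that] by (auto simp: is_subspace_def)
  show "(\<forall>w\<in>verts Q. U w = {0\<^sub>v (rdim M w)}) \<or> (\<forall>w\<in>verts Q. U w = carrier_vec (rdim M w))"
  proof (cases "U v = {0\<^sub>v (rdim M v)}")
    case True
    then show ?thesis using other by metis
  next
    case False
    note s = sub[OF v(1), unfolded v(2) is_subspace_def]
    obtain x where x: "x \<in> U v" "x \<noteq> 0\<^sub>v 1" using False s unfolding v(2) by blast
    have xc: "x \<in> carrier_vec 1" using s x by blast
    have x0: "x $ 0 \<noteq> 0"
    proof
      assume "x $ 0 = 0"
      then have "x = 0\<^sub>v 1" using xc by (intro eq_vecI) auto
      then show False using x by simp
    qed
    have "y \<in> U v" if y: "y \<in> carrier_vec 1" for y
    proof -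
      have "y = (y $ 0 / x $ 0) \<cdot>\<^sub>v x" using y xc x0 by (intro eq_vecI) auto
      then show ?thesis using s x(1) by metis
    qed
    then have "U v = carrier_vec (rdim M v)" using s unfolding v(2) by blast
    then show ?thesis using other triv by metis
  qed
qed

section \<open>From the classification to finiteness and to the projective or injective
  alternative\<close>

lemma rep_iso_if_no_arrow_acts:
  assumes M: "is_rep_J2 Q M" and N: "is_rep_J2 Q N" and d: "\<forall>w\<in>verts Q. rdim M w = rdim N w"
    and Q: "wf_quiver Q"
    and zM: "\<And>a. a \<in> arrs Q \<Longrightarrow> rmap M a = 0\<^sub>m (rdim M (tgt Q a)) (rdim M (src Q a))"
    and zN: "\<And>a. a \<in> arrs Q \<Longrightarrow> rmap N a = 0\<^sub>m (rdim N (tgt Q a)) (rdim N (src Q a))"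
  shows "rep_iso Q M N"
  unfolding rep_iso_def
  by (intro exI[of _ "\<lambda>w. 1\<^sub>m (rdim M w)"]) (use d zM zN wf_quiverD[OF Q] in \<open>simp add: is_hom_def\<close>)

text \<open>One choice per index suffices. An index realized by no object contributes an arbitrary
  element, which does no harm to finiteness.\<close>

lemma finite_representatives:
  assumes "finite I" and "\<And>M. P M \<Longrightarrow> \<exists>i\<in>I. R i M"
    and "\<And>i M N. i \<in> I \<Longrightarrow> P M \<Longrightarrow> P N \<Longrightarrow> R i M \<Longrightarrow> R i N \<Longrightarrow> equ M N"
  shows "\<exists>S. finite S \<and> (\<forall>M. P M \<longrightarrow> (\<exists>N\<in>S. equ M N))"
proof (intro exI conjI allI impI)
  show "finite ((\<lambda>i. SOME N. P N \<and> R i N) ` I)" using assms(1) by simp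
  fix M assume M: "P M"
  then obtain i where i: "i \<in> I" "R i M" using assms(2) by blast
  then have "P (SOME N. P N \<and> R i N) \<and> R i (SOME N. P N \<and> R i N)"
    using M someI[of "\<lambda>N. P N \<and> R i N" M] by blast
  then show "\<exists>N\<in>(\<lambda>i. SOME N. P N \<and> R i N) ` I. equ M N" using assms(3)[OF i(1) M] i by blast
qed

text \<open>The degree bound excludes that both ends of an acting arrow have a second
  parallel-direction arrow (out-degree and in-degree at least 2), so either \<open>Q\<close> or its
  opposite meets the hypotheses of the previous analysis. The simple case keeps the vanishing of the
  arrows, so that dimensions alone determine the module.\<close>

lemma indecomposable_cases:
  fixes M :: "('v, 'a, 'k::field) rep"
  assumes Q: "finite_connected_quiver Q" and adm: "pre_admissible n Q"
    and M: "is_rep_J2 Q M" and ind: "indecomposable Q M"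
  obtains (simple) v where "v \<in> verts Q" "rdim M v = 1" "\<forall>w\<in>verts Q. w \<noteq> v \<longrightarrow> rdim M w = 0"
      "\<forall>a\<in>arrs Q. rmap M a = 0\<^sub>m (rdim M (tgt Q a)) (rdim M (src Q a))"
    | (projective) v x where "v \<in> verts Q" "free_on Q M v x"
    | (injective) v x where "v \<in> verts Q" "free_on (op_quiver Q) (op_rep M) v x"
proof (cases "\<forall>a\<in>arrs Q. rmap M a = 0\<^sub>m (rdim M (tgt Q a)) (rdim M (src Q a))")
  case True
  then show ?thesis
    using concentrated_if_no_arrow_acts[OF _ M ind] Q simple unfolding finite_connected_quiver_def by blast
next
  case False
  then obtain a where a: "a \<in> arrs Q" "rmap M a \<noteq> 0\<^sub>m (rdim M (tgt Q a)) (rdim M (src Q a))" by blast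
  have wf: "wf_quiver Q" and fin: "finite (arrs Q)" using Q by (auto simp: finite_connected_quiver_def)
  have deg: "outdeg Q (src Q b) + indeg Q (tgt Q b) \<le> 3" if "b \<in> arrs Q" for b
    using adm that by (simp add: pre_admissible_def)
  have le2: "indeg Q v \<le> 2 \<and> outdeg Q v \<le> 2" if "v \<in> verts Q" for v
    using adm that by (auto simp: pre_admissible_def)
  have "(\<exists>v\<in>verts Q. \<exists>x. free_on Q M v x) \<or> (\<exists>v\<in>verts Q. \<exists>x. free_on (op_quiver Q) (op_rep M) v x)"
  proof (cases "outdeg Q (src Q a) \<le> 1")
    case True
    then show ?thesis
      using indecomposable_generated_or_cogenerated[OF wf fin M ind a True _ deg]
        le2 wf_quiverD(2)[OF wf a(1)] by blast
  next
    case False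
    then have i: "indeg Q (tgt Q a) \<le> 1" using deg[OF a(1)] by simp
    have "rmap (op_rep M) a \<noteq> 0\<^sub>m (rdim M (src Q a)) (rdim M (tgt Q a))"
      using a(2) transpose_mat_eq[of "rmap M a" "0\<^sub>m (rdim M (tgt Q a)) (rdim M (src Q a))"] by simp
    then show ?thesis
      using indecomposable_generated_or_cogenerated[of "op_quiver Q" "op_rep M" a]
        wf fin is_rep_op[OF M] indecomposable_op[OF wf M ind] a(1) i
        le2[OF wf_quiverD(1)[OF wf a(1)]] deg by (auto simp: add.commute)
  qed
  then show ?thesis using projective injective by blast
qed

lemma rep_finite_pre_admissible:
  assumes Q: "finite_connected_quiver Q" and adm: "pre_admissible n Q"
  shows "rep_finite_J2 Q TYPE('k::field)"
proof -
  have wf: "wf_quiver Q" and fin: "finite (verts Q)" using Q by (auto simp: finite_connected_quiver_def)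
  \<comment> \<open>The indices 0, 1, 2 stand for simple, projective and injective. The types may
    overlap; all that matters is that a type and a vertex determine the isomorphism class.\<close>
  define R where "R t M = (case t of (i, v) \<Rightarrow>
      if i = (0::nat) then rdim M v = 1 \<and> (\<forall>w\<in>verts Q. w \<noteq> v \<longrightarrow> rdim M w = 0)
        \<and> (\<forall>a\<in>arrs Q. rmap M a = 0\<^sub>m (rdim M (tgt Q a)) (rdim M (src Q a)))
      else if i = 1 then \<exists>x. free_on Q M v x
      else \<exists>x. free_on (op_quiver Q) (op_rep M) v x)" for t and M :: "('a, 'b, 'k) rep"
  have "\<exists>S :: ('a, 'b, 'k) rep set. finite S \<and>
      (\<forall>M. is_rep_J2 Q M \<and> indecomposable Q M \<longrightarrow> (\<exists>N\<in>S. rep_iso Q M N))"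
  proof (rule finite_representatives[where R = R])
    show "finite ({0::nat, 1, 2} \<times> verts Q)" using fin by simp
  next
    fix M :: "('a, 'b, 'k) rep" assume "is_rep_J2 Q M \<and> indecomposable Q M"
    then have M: "is_rep_J2 Q M" "indecomposable Q M" by auto
    show "\<exists>t\<in>{0::nat, 1, 2} \<times> verts Q. R t M"
    proof (cases rule: indecomposable_cases[OF Q adm M])
      case (1 v)
      then show ?thesis by (intro bexI[of _ "(0, v)"]) (auto simp: R_def)
    next
      case (2 v x)
      then show ?thesis by (intro bexI[of _ "(1, v)"]) (auto simp: R_def)
    next
      case (3 v x)
      then show ?thesis by (intro bexI[of _ "(2, v)"]) (auto simp: R_def)
    qed
  next
    fix t and M N :: "('a, 'b, 'k) rep"
    assume t: "t \<in> {0::nat, 1, 2} \<times> verts Q"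
      and "is_rep_J2 Q M \<and> indecomposable Q M" "is_rep_J2 Q N \<and> indecomposable Q N"
      and R: "R t M" "R t N"
    then have M: "is_rep_J2 Q M" and N: "is_rep_J2 Q N" by auto
    obtain i v where iv: "t = (i, v)" "v \<in> verts Q" using t by auto
    consider "i = 0" | "i = 1" | "i \<noteq> 0" "i \<noteq> 1" by auto
    then show "rep_iso Q M N"
    proof cases
      case 1
      note R0 = R[unfolded iv R_def 1 prod.case if_True simp_thms]
      have "\<forall>w\<in>verts Q. rdim M w = rdim N w" using R0 by metis
      then show ?thesis
        by (rule rep_iso_if_no_arrow_acts[OF M N _ wf]) (use R0 in blast)+
    next
      case 2
      then obtain x y where "free_on Q M v x" "free_on Q N v y" using R iv by (auto simp: R_def)
      then show ?thesis by (rule free_on_iso[OF wf iv(2) M N])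
    next
      case 3
      then obtain x y where xy: "free_on (op_quiver Q) (op_rep M) v x" "free_on (op_quiver Q) (op_rep N) v y"
        using R iv by (auto simp: R_def)
      have "rep_iso (op_quiver Q) (op_rep M) (op_rep N)"
        by (rule free_on_iso[OF _ _ is_rep_op[OF M] is_rep_op[OF N] xy]) (simp_all add: wf iv)
      then show ?thesis
        using rep_iso_op[OF _ is_rep_op[OF M] is_rep_op[OF N]] wf by simp
    qed
  qed
  then show ?thesis by (simp add: rep_finite_J2_def)
qed

lemma projective_or_injective:
  assumes Q: "finite_connected_quiver Q" and adm: "pre_admissible n Q"
    and M: "is_rep_J2 Q M" and ind: "indecomposable Q M" and ns: "\<not> simple_rep Q M"
  shows "projective_rep Q M \<or> injective_rep Q M"
proof -
  have wf: "wf_quiver Q" using Q by (auto simp: finite_connected_quiver_def)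
  show ?thesis
  proof (cases rule: indecomposable_cases[OF Q adm M ind])
    case (1 v)
    then show ?thesis using simple_if_concentrated[OF 1(1-3)] ns by simp
  next
    case (2 v x)
    then show ?thesis using free_on_projective[OF wf 2(1) M 2(2)] by simp
  next
    case (3 v x)
    have "projective_rep (op_quiver Q) (op_rep M)"
      by (rule free_on_projective[OF _ _ is_rep_op[OF M] 3(2)]) (simp_all add: wf 3(1))
    then show ?thesis using injective_if_op_projective[OF wf M] by simp
  qed
qed

section \<open>Strings\<close>

text \<open>Two neighbouring letters of the same direction would form a path of length two, which
  lies in the ideal.\<close>

lemma string_letters_alternate:
  assumes "is_string Q J2_path w" and i: "Suc i < length w"
  shows "snd (w ! Suc i) = (\<not> snd (w ! i))"
proof -
  have len: "length (take 2 (drop i w)) = 2" using i by simp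
  have "\<not> (snd (w ! i) \<and> snd (w ! Suc i))"
  proof
    assume "snd (w ! i) \<and> snd (w ! Suc i)"
    then have "\<forall>j\<in>{i..i + 1}. snd (w ! j)" by (auto simp: le_Suc_eq dest!: le_antisym)
    then have "\<not> J2_path (map fst (take (Suc 1) (drop i w)))"
      using assms unfolding is_string_def by (metis Suc_eq_plus1)
    then show False using len by (simp add: J2_path_def numeral_2_eq_2)
  qed
  moreover have "\<not> (\<not> snd (w ! i) \<and> \<not> snd (w ! Suc i))"
  proof
    assume "\<not> snd (w ! i) \<and> \<not> snd (w ! Suc i)"
    then have "\<forall>j\<in>{i..i + 1}. \<not> snd (w ! j)" by (auto simp: le_Suc_eq dest!: le_antisym)
    then have "\<not> J2_path (rev (map fst (take (Suc 1) (drop i w))))"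
      using assms unfolding is_string_def by (metis Suc_eq_plus1)
    then show False using len by (simp add: J2_path_def numeral_2_eq_2)
  qed
  ultimately show ?thesis by blast
qed

lemma two_le_card_if_distinct:
  assumes "finite A" "a \<in> A" "b \<in> A" "a \<noteq> b"
  shows "2 \<le> card A"
  using card_mono[of A "{a, b}"] assms by simp

text \<open>The middle letter of a zigzag of three arrows violates \<open>\<delta>\<^sup>+(v) + \<delta>\<^sup>-(u) \<le> 3\<close>.\<close>
lemma string_length_le_2:
  assumes fin: "finite (arrs Q)" and adm: "pre_admissible n Q" and w: "is_string Q J2_path w"
  shows "length w \<le> 2"
proof (rule ccontr)
  assume "\<not> length w \<le> 2"
  then have len: "Suc 0 < length w" "Suc (Suc 0) < length w" by auto
  obtain a p b q c r where l: "w ! 0 = (a, p)" "w ! Suc 0 = (b, q)" "w ! Suc (Suc 0) = (c, r)"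
    by (metis surj_pair)
  have "w ! 0 \<in> set w" "w ! Suc 0 \<in> set w" "w ! Suc (Suc 0) \<in> set w" using len by (auto intro: nth_mem)
  then have arr: "a \<in> arrs Q" "b \<in> arrs Q" "c \<in> arrs Q"
    using w l unfolding is_string_def by (force simp: image_subset_iff)+
  have qr: "q = (\<not> p)" "r = p"
    using string_letters_alternate[OF w len(1)] string_letters_alternate[OF w len(2)] l by auto
  have "tL Q (w ! 0) = sL Q (w ! Suc 0) \<and> w ! Suc 0 \<noteq> invL (w ! 0)"
    "tL Q (w ! Suc 0) = sL Q (w ! Suc (Suc 0)) \<and> w ! Suc (Suc 0) \<noteq> invL (w ! Suc 0)"
    using w len unfolding is_string_def by blast+
  then have ne: "a \<noteq> b" "b \<noteq> c"
    and st: "if p then tgt Q a = tgt Q b \<and> src Q b = src Q c else src Q a = src Q b \<and> tgt Q b = tgt Q c"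
    by (auto simp: l qr tL_def sL_def invL_def)
  \<comment> \<open>Whichever way \<open>b\<close> points, one neighbour shares its target and the
    other its source, so both degrees are at least 2 and add up to at least 4.\<close>
  have "2 \<le> indeg Q (tgt Q b) \<and> 2 \<le> outdeg Q (src Q b)"
    unfolding indeg_def outdeg_def using fin arr ne st
    by (auto split: if_splits intro: two_le_card_if_distinct[of _ a b] two_le_card_if_distinct[of _ b c])
  then show False using adm arr(2) by (auto simp: pre_admissible_def dest!: bspec)
qed

text \<open>The third power of a band would be a string of length at least 3.\<close>

lemma no_band:
  assumes fin: "finite (arrs Q)" and adm: "pre_admissible n Q"
  shows "\<not> is_band Q J2_path w"
proof
  assume w: "is_band Q J2_path w"
  then have "is_string Q J2_path (concat (replicate 3 w))" "w \<noteq> []"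
    by (auto simp: is_band_def is_string_def)
  then show False
    using string_length_le_2[OF fin adm, of "concat (replicate 3 w)"]
    by (cases w) (simp_all add: numeral_3_eq_3)
qed

text \<open>All paths of length two lie in the ideal, so the sets of admissible continuations are
  empty and only the degrees matter.\<close>

lemma string_algebra_J2:
  assumes "pre_admissible n Q"
  shows "string_algebra Q J2_path"
  using assms by (auto simp: string_algebra_def pre_admissible_def J2_path_def)

theorem theorem2p10:
  fixes n :: nat and Q :: "('v, 'a) quiver"
  assumes "n \<ge> 2"
    and "finite_connected_quiver Q"
    and "pre_admissible n Q"
  shows "string_algebra Q J2_path
    \<and> (\<forall>w. is_string Q J2_path w \<longrightarrow> length w \<le> 2)
    \<and> \<not> (\<exists>w. is_band Q J2_path w)
    \<and> rep_finite_J2 Q TYPE('k::field)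
    \<and> (\<forall>M :: ('v, 'a, 'k::field) rep. is_rep_J2 Q M \<and> indecomposable Q M \<and> \<not> simple_rep Q M
           \<longrightarrow> projective_rep Q M \<or> injective_rep Q M)"
proof -
  have fin: "finite (arrs Q)" using assms(2) by (simp add: finite_connected_quiver_def)
  show ?thesis
    using string_algebra_J2[OF assms(3)] string_length_le_2[OF fin assms(3)] no_band[OF fin assms(3)]
      rep_finite_pre_admissible[OF assms(2,3)] projective_or_injective[OF assms(2,3)] by blast
qed

end
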